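(* Let $L$ and $T$ be positive integers, let $p_1<p_2<\cdots<p_L$ be prime numbers, let $q_0$ be a prime power with $q_0\ge N_L$, and set $q=q_0^{p_1p_2\cdots p_L}$, where $N_i=p_i+2L+2T-2$ for every $i\in[L]$. Let $A\in\mathbb{F}_q^{a\times b}$ and $B\in\mathbb{F}_q^{b\times c}$ with $L\mid b$. Then the FTP code with partitioning parameter $L$ and security parameter $T$ (described in the context) uses $N_L$ servers, is $T$-secure, allows the user to recover $AB$ from the servers' responses, and has total communication rate $$\mathcal{R}=\left(\frac{N_L b}{L}\left(\frac{1}{a}+\frac{1}{c}\right)+\sum_{i=1}^{L}\frac{N_i}{p_i}\right)^{-1}.$$
   Context: Notation: $[M]=\{1,\dots,M\}$, $[M:N]=\{M,\dots,N\}$. For a finite field extension $\mathbb{E}/\mathbb{F}$ of degree $s$, $\operatorname{tr}_{\mathbb{E}/\mathbb{F}}(x)=x+x^{|\mathbb{F}|}+\cdots+x^{|\mathbb{F}|^{s-1}}$; traces are applied entrywise to matrices. FTP code (field trace polynomial code) with parameters $L,T,p_1<\dots<p_L,q_0$ as in the claim: Partition $A=[A_1\ \cdots\ A_L]$ with $A_i\in\mathbb{F}_q^{a\times b/L}$ and $B^{\intercal}=[B_1^{\intercal}\ \cdots\ B_L^{\intercal}]$ with $B_i\in\mathbb{F}_q^{b/L\times c}$, so $AB=\sum_i A_iB_i$. Let $n=N_L+L$. For $i\in[L]$ pick $\alpha_i\in\mathbb{F}_q$ with $[\mathbb{F}_{q_0}(\alpha_i):\mathbb{F}_{q_0}]=p_i$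 (so $\mathbb{F}_q=\mathbb{F}_{q_0}(\alpha_1,\dots,\alpha_L)$), and let $F_i=\mathbb{F}_{q_0}(\alpha_j: j\in[L], j\ne i)$, so $[\mathbb{F}_q:F_i]=p_i$. Pick distinct $\alpha_{L+1},\dots,\alpha_n\in\mathbb{F}_{q_0}$. Choose $R_1,\dots,R_T\in\mathbb{F}_q^{a\times b/L}$ and $S_1,\dots,S_T\in\mathbb{F}_q^{b/L\times c}$ independently and uniformly at random, independent of $(A,B)$. Let $f,g$ be the polynomials (with matrix coefficients over $\mathbb{F}_q$) of degree at most $L+T-1$ with $f(\alpha_i)=A_i$, $g(\alpha_i)=B_i$ for $i\in[L]$ and $f(\alpha_{L+j})=R_j$, $g(\alpha_{L+j})=S_j$ for $j\in[T]$; let $h=fg$. Upload: server $j\in[N_L]$ receives $f(\alpha_{L+j})$ and $g(\alpha_{L+j})$ and computes $h(\alpha_{L+j})=f(\alpha_{L+j})g(\alpha_{L+j})$. Let $v_j=\prod_{i\in[n],i\ne j}(\alpha_j-\alpha_i)^{-1}$, $U_i=[L+1:L+N_i]$, and $k_i(x)=\prod_{j\in[n]\setminus(U_i\cup\{i\})}(x-\alpha_j)$. Download: for each $i\in[L]$ and each server $j\in[N_i]$, server $j$ sends the $a\times c$ matrix over $F_i$ given by $\operatorname{tr}_{\mathbb{F}_q/F_i}(v_{L+j}k_i(\alpha_{L+j})h(\alpha_{L+j}))$. $T$-secure: for every set of $T$ servers, the mutual information between $(A,B)$ and the data uploaded to those servers is zero. Total communication rate: (number of $\mathbb{F}_{q_0}$-symbols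 of $AB$)/(number of $\mathbb{F}_{q_0}$-symbols uploaded plus downloaded), where an element of $\mathbb{F}_q$ counts as $p_1\cdots p_L$ symbols and an element of $F_i$ as $\prod_{j\ne i}p_j$ symbols. *)

theory Defs
  imports "Jordan_Normal_Form.Matrix" "HOL-Probability.Information" "HOL-Probability.Probability_Mass_Function"
    "HOL-Computational_Algebra.Polynomial"
begin

section \<open>Finite field notions inside a finite field type 'a (playing the role of F_q)\<close>

definition is_subfield :: "'a::field set \<Rightarrow> bool" where
  "is_subfield K \<longleftrightarrow> 0 \<in> K \<and> 1 \<in> K \<and>
     (\<forall>x\<in>K. \<forall>y\<in>K. x + y \<in> K \<and> x * y \<in> K) \<and>
     (\<forall>x\<in>K. - x \<in> K \<and> inverse x \<in> K)"

definition gen_field :: "'a::field set \<Rightarrow> 'a set" where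
  "gen_field S = \<Inter> {K. is_subfield K \<and> S \<subseteq> K}"

definition base_field :: "nat \<Rightarrow> 'a::{field,finite} set" where
  "base_field q0 = (THE K. is_subfield K \<and> card K = q0)"

definition field_degree :: "'a::{field,finite} set \<Rightarrow> 'a set \<Rightarrow> nat" where
  "field_degree K E = (THE d. card E = card K ^ d)"

definition field_trace :: "'a::{field,finite} set \<Rightarrow> 'a \<Rightarrow> 'a" where
  "field_trace K x = (\<Sum>k < field_degree K UNIV. x ^ (card K ^ k))"

definition ftp_N :: "(nat \<Rightarrow> nat) \<Rightarrow> nat \<Rightarrow> nat \<Rightarrow> nat \<Rightarrow> nat" where
  "ftp_N p L T i = p i + 2 * L + 2 * T - 2"

definition ftp_F :: "nat \<Rightarrow> nat \<Rightarrow> (nat \<Rightarrow> 'a::{field,finite}) \<Rightarrow> nat \<Rightarrow> 'a set" where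
  "ftp_F q0 L \<alpha> i = gen_field (base_field q0 \<union> \<alpha> ` ({1..L} - {i}))"

definition ftp_nodes :: "nat \<Rightarrow> nat \<Rightarrow> nat \<Rightarrow> (nat \<Rightarrow> nat) \<Rightarrow> (nat \<Rightarrow> 'a::{field,finite}) \<Rightarrow> bool" where
  "ftp_nodes q0 L T p \<alpha> \<longleftrightarrow>
     (\<forall>i\<in>{1..L}. field_degree (base_field q0) (gen_field (base_field q0 \<union> {\<alpha> i})) = p i) \<and>
     (\<forall>j\<in>{L+1..ftp_N p L T L + L}. \<alpha> j \<in> base_field q0) \<and>
     inj_on \<alpha> {L+1..ftp_N p L T L + L}"

definition eval_mat :: "'a::comm_ring_1 poly mat \<Rightarrow> 'a \<Rightarrow> 'a mat" where
  "eval_mat F x = map_mat (\<lambda>q. poly q x) F"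

definition interp_mat :: "nat \<Rightarrow> nat \<Rightarrow> nat \<Rightarrow> ('a::field \<times> 'a mat) list \<Rightarrow> 'a poly mat" where
  "interp_mat nr nc d pts = (THE F. F \<in> carrier_mat nr nc \<and>
      (\<forall>r<nr. \<forall>s<nc. degree (F $$ (r, s)) \<le> d) \<and>
      (\<forall>(x, M) \<in> set pts. eval_mat F x = M))"

definition blockA :: "nat \<Rightarrow> nat \<Rightarrow> 'a mat \<Rightarrow> nat \<Rightarrow> 'a mat" where
  "blockA L b A i = Matrix.mat (dim_row A) (b div L) (\<lambda>(r, s). A $$ (r, (i - 1) * (b div L) + s))"

definition blockB :: "nat \<Rightarrow> nat \<Rightarrow> 'a mat \<Rightarrow> nat \<Rightarrow> 'a mat" where
  "blockB L b B i = Matrix.mat (b div L) (dim_col B) (\<lambda>(r, s). B $$ ((i - 1) * (b div L) + r, s))"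

definition ftp_rand :: "nat \<Rightarrow> nat \<Rightarrow> nat \<Rightarrow> nat \<Rightarrow> nat \<Rightarrow> ('a mat list \<times> 'a mat list) set" where
  "ftp_rand L T a b c = {(R, S). length R = T \<and> length S = T \<and>
      set R \<subseteq> carrier_mat a (b div L) \<and> set S \<subseteq> carrier_mat (b div L) c}"

definition ftp_f :: "nat \<Rightarrow> nat \<Rightarrow> (nat \<Rightarrow> 'a::field) \<Rightarrow> nat \<Rightarrow> nat \<Rightarrow> 'a mat \<Rightarrow> 'a mat list \<Rightarrow> 'a poly mat" where
  "ftp_f L T \<alpha> a b A R = interp_mat a (b div L) (L + T - 1)
     (map (\<lambda>i. (\<alpha> i, blockA L b A i)) [1..<L+1] @ map (\<lambda>j. (\<alpha> (L + j), R ! (j - 1))) [1..<T+1])"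

definition ftp_g :: "nat \<Rightarrow> nat \<Rightarrow> (nat \<Rightarrow> 'a::field) \<Rightarrow> nat \<Rightarrow> nat \<Rightarrow> 'a mat \<Rightarrow> 'a mat list \<Rightarrow> 'a poly mat" where
  "ftp_g L T \<alpha> b c B S = interp_mat (b div L) c (L + T - 1)
     (map (\<lambda>i. (\<alpha> i, blockB L b B i)) [1..<L+1] @ map (\<lambda>j. (\<alpha> (L + j), S ! (j - 1))) [1..<T+1])"

definition ftp_upload :: "nat \<Rightarrow> nat \<Rightarrow> (nat \<Rightarrow> 'a::field) \<Rightarrow> nat \<Rightarrow> nat \<Rightarrow> nat
    \<Rightarrow> 'a mat \<Rightarrow> 'a mat \<Rightarrow> 'a mat list \<Rightarrow> 'a mat list \<Rightarrow> nat \<Rightarrow> 'a mat \<times> 'a mat" where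
  "ftp_upload L T \<alpha> a b c A B R S j =
     (eval_mat (ftp_f L T \<alpha> a b A R) (\<alpha> (L + j)), eval_mat (ftp_g L T \<alpha> b c B S) (\<alpha> (L + j)))"

definition ftp_v :: "nat \<Rightarrow> (nat \<Rightarrow> 'a::field) \<Rightarrow> nat \<Rightarrow> 'a" where
  "ftp_v n \<alpha> j = inverse (\<Prod>i\<in>{1..n} - {j}. \<alpha> j - \<alpha> i)"

definition ftp_k :: "nat \<Rightarrow> nat \<Rightarrow> nat \<Rightarrow> (nat \<Rightarrow> 'a::field) \<Rightarrow> nat \<Rightarrow> 'a \<Rightarrow> 'a" where
  "ftp_k n L Ni \<alpha> i x = (\<Prod>j\<in>{1..n} - ({L+1..L+Ni} \<union> {i}). x - \<alpha> j)"

definition ftp_answer :: "nat \<Rightarrow> nat \<Rightarrow> nat \<Rightarrow> (nat \<Rightarrow> nat) \<Rightarrow> (nat \<Rightarrow> 'a::{field,finite}) \<Rightarrow> nat \<Rightarrow> nat \<Rightarrow> nat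
    \<Rightarrow> 'a mat \<Rightarrow> 'a mat \<Rightarrow> 'a mat list \<Rightarrow> 'a mat list \<Rightarrow> nat \<Rightarrow> nat \<Rightarrow> 'a mat" where
  "ftp_answer q0 L T p \<alpha> a b c A B R S i j =
     (let n = ftp_N p L T L + L;
          up = ftp_upload L T \<alpha> a b c A B R S j;
          hv = fst up * snd up
      in map_mat (field_trace (ftp_F q0 L \<alpha> i))
           ((ftp_v n \<alpha> (L + j) * ftp_k n L (ftp_N p L T i) \<alpha> i (\<alpha> (L + j))) \<cdot>\<^sub>m hv))"

definition ftp_download :: "nat \<Rightarrow> nat \<Rightarrow> nat \<Rightarrow> (nat \<Rightarrow> nat) \<Rightarrow> (nat \<Rightarrow> 'a::{field,finite}) \<Rightarrow> nat \<Rightarrow> nat \<Rightarrow> nat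
    \<Rightarrow> 'a mat \<Rightarrow> 'a mat \<Rightarrow> 'a mat list \<Rightarrow> 'a mat list \<Rightarrow> 'a mat list list" where
  "ftp_download q0 L T p \<alpha> a b c A B R S =
     map (\<lambda>i. map (\<lambda>j. ftp_answer q0 L T p \<alpha> a b c A B R S i j) [1..<ftp_N p L T i + 1]) [1..<L+1]"

text \<open>Total communication rate, counting F_{q0}-symbols: an element of F_q is
  p_1...p_L symbols, an element of F_i is prod_{j~=i} p_j symbols. Upload: each of the
  N_L servers receives an (a x b/L) and a (b/L x c) matrix over F_q; download: for each i,
  N_i servers each send an (a x c) matrix over F_i; AB is an (a x c) matrix over F_q.\<close>
definition ftp_rate :: "nat \<Rightarrow> nat \<Rightarrow> (nat \<Rightarrow> nat) \<Rightarrow> nat \<Rightarrow> nat \<Rightarrow> nat \<Rightarrow> real" where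
  "ftp_rate L T p a b c =
     (let P = (\<Prod>j\<in>{1..L}. p j);
          up = ftp_N p L T L * (a * (b div L) + (b div L) * c) * P;
          down = (\<Sum>i\<in>{1..L}. ftp_N p L T i * (a * c) * (\<Prod>j\<in>{1..L} - {i}. p j))
      in real (a * c * P) / real (up + down))"

end

theory Submission
  imports Defs
begin

text \<open>
  Decoding: for \<open>s < p\<^sub>i\<close> the polynomial \<open>x\<^sup>s k\<^sub>i h\<close> has degree at most \<open>n - 2\<close>, so its sum
  over all nodes with the weights \<open>v\<^sub>j\<close> vanishes. As \<open>k\<^sub>i\<close> kills every node outside
  \<open>U\<^sub>i \<union> {i}\<close> and the nodes in \<open>U\<^sub>i\<close> lie in \<open>F\<^sub>i\<close>, taking traces expresses
  \<open>tr (\<alpha>\<^sub>i\<^sup>s v\<^sub>i k\<^sub>i(\<alpha>\<^sub>i) h(\<alpha>\<^sub>i))\<close> through the downloads. The conjugates of \<open>\<alpha>\<^sub>i\<close> over \<open>F\<^sub>i\<close> are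
  distinct, because \<open>p\<^sub>i\<close> is coprime to the degree of \<open>F\<^sub>i\<close> over the base field, so a Vandermonde
  argument shows that these \<open>p\<^sub>i\<close> traces determine \<open>h(\<alpha>\<^sub>i) = A\<^sub>i B\<^sub>i\<close>.

  Security: for fixed \<open>(A, B)\<close> the shares of any \<open>T\<close> servers together with the blocks of \<open>A\<close> and
  \<open>B\<close> fix \<open>f\<close> and \<open>g\<close>, so the randomness is mapped bijectively to the shares. Hence the shares are
  uniform with a law independent of \<open>(A, B)\<close>.
\<close>

section \<open>Lagrange interpolation\<close>

text \<open>The nodes form an indexed family, so for \<open>J = {1..n}\<close> and
  \<open>x = \<alpha>\<close> the scalar factor is exactly the weight
  \<open>ftp_v n \<alpha> j\<close>.\<close>

definition lagrange_basis :: "('i \<Rightarrow> 'a::field) \<Rightarrow> 'i set \<Rightarrow> 'i \<Rightarrow> 'a poly" where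
  "lagrange_basis x J j =
     smult (inverse (\<Prod>i\<in>J - {j}. x j - x i)) (\<Prod>i\<in>J - {j}. [:- x i, 1:])"

lemma poly_lagrange_basis:
  assumes "finite J" "inj_on x J" "i \<in> J" "j \<in> J"
  shows "poly (lagrange_basis x J j) (x i) = (if i = j then 1 else 0)"
proof (cases "i = j")
  case True
  have "(\<Prod>i\<in>J - {j}. x j - x i) \<noteq> 0"
    using assms by (auto simp: inj_on_def)
  then show ?thesis
    using True by (simp add: lagrange_basis_def poly_prod)
next
  case False
  then have "(\<Prod>k\<in>J - {j}. x i - x k) = 0"
    using assms by (intro prod_zero) auto
  then show ?thesis
    using False by (simp add: lagrange_basis_def poly_prod)
qed

lemma degree_lagrange_basis: "degree (lagrange_basis x J j) \<le> card (J - {j})"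
  unfolding lagrange_basis_def by (intro order_trans[OF degree_smult_le]) (simp add: degree_prod_sum_eq)

lemma coeff_lagrange_basis:
  "poly.coeff (lagrange_basis x J j) (card (J - {j})) = inverse (\<Prod>i\<in>J - {j}. x j - x i)"
proof -
  have "degree (\<Prod>i\<in>J - {j}. [:- x i, 1:]) = card (J - {j})"
    by (simp add: degree_prod_sum_eq)
  moreover have "lead_coeff (\<Prod>i\<in>J - {j}. [:- x i, 1:]) = 1"
    by (simp add: lead_coeff_prod)
  ultimately show ?thesis
    by (simp add: lagrange_basis_def)
qed

text \<open>Both sides have degree below \<open>card J\<close> and agree at \<open>card J\<close>
  distinct points.\<close>

lemma lagrange_interpolation:
  assumes "finite J" "inj_on x J" "degree g < card J"
  shows "g = (\<Sum>j\<in>J. smult (poly g (x j)) (lagrange_basis x J j))"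
proof (rule poly_eqI_degree[where A = "x ` J"])
  fix y assume "y \<in> x ` J"
  then obtain i where i: "i \<in> J" "y = x i" by auto
  have "poly (\<Sum>j\<in>J. smult (poly g (x j)) (lagrange_basis x J j)) y
      = (\<Sum>j\<in>J. poly g (x j) * (if i = j then 1 else 0))"
    using assms i by (auto simp: poly_sum poly_lagrange_basis intro!: sum.cong)
  then show "poly g y = poly (\<Sum>j\<in>J. smult (poly g (x j)) (lagrange_basis x J j)) y"
    using assms i by (simp add: sum.delta' flip: of_bool_def)
next
  show "degree g < card (x ` J)"
    using assms by (simp add: card_image)
  have "degree (\<Sum>j\<in>J. smult (poly g (x j)) (lagrange_basis x J j)) \<le> card J - 1"
  proof (rule degree_sum_le[OF assms(1)])
    fix j assume "j \<in> J"
    then have "card (J - {j}) = card J - 1" using assms(1) by simp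
    then show "degree (smult (poly g (x j)) (lagrange_basis x J j)) \<le> card J - 1"
      using degree_smult_le degree_lagrange_basis order_trans by metis
  qed
  then show "degree (\<Sum>j\<in>J. smult (poly g (x j)) (lagrange_basis x J j)) < card (x ` J)"
    using assms by (simp add: card_image)
qed

text \<open>The sum is the coefficient of degree \<open>card J - 1\<close> in the Lagrange form of
  \<open>g\<close>, whose degree is smaller. In coding terms the weights are the parity check of a
  Reed-Solomon code of codimension one.\<close>

lemma sum_poly_div_node_differences_eq_0:
  fixes x :: "'i \<Rightarrow> 'a::field"
  assumes "finite J" "inj_on x J" "degree g + 2 \<le> card J"
  shows "(\<Sum>j\<in>J. inverse (\<Prod>i\<in>J - {j}. x j - x i) * poly g (x j)) = 0"
proof -
  have "0 = poly.coeff g (card J - 1)"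
    using assms(3) by (simp add: coeff_eq_0)
  also have "\<dots> = poly.coeff (\<Sum>j\<in>J. smult (poly g (x j)) (lagrange_basis x J j)) (card J - 1)"
    using lagrange_interpolation[OF assms(1,2), of g] assms(3) by simp
  also have "\<dots> = (\<Sum>j\<in>J. inverse (\<Prod>i\<in>J - {j}. x j - x i) * poly g (x j))"
  proof -
    have "poly.coeff (lagrange_basis x J j) (card J - 1) = inverse (\<Prod>i\<in>J - {j}. x j - x i)"
      if "j \<in> J" for j
      using coeff_lagrange_basis[of x J j] that assms(1) by simp
    then show ?thesis
      by (simp add: coeff_sum mult.commute)
  qed
  finally show ?thesis by simp
qed

text \<open>A Vandermonde system has trivial kernel: weighting its equations with the coefficients
  of the \<open>j\<close>-th Lagrange polynomial isolates \<open>w j\<close>.\<close>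

lemma eq_0_if_power_sums_eq_0:
  fixes x w :: "'i \<Rightarrow> 'a::field"
  assumes "finite J" "inj_on x J" "j \<in> J"
    and sums: "\<And>s. s < card J \<Longrightarrow> (\<Sum>i\<in>J. x i ^ s * w i) = 0"
  shows "w j = 0"
proof -
  let ?l = "lagrange_basis x J j"
  have "degree ?l < card J"
    using degree_lagrange_basis[of x J j] assms by (metis card_Diff1_less order_le_less_trans)
  \<comment> \<open>Padding with zero coefficients turns the range of \<open>s\<close> into that of
    the hypothesis, whatever the exact degree.\<close>
  then have "poly ?l y = (\<Sum>s<card J. poly.coeff ?l s * y ^ s)" for y
    unfolding poly_altdef by (intro sum.mono_neutral_left) (auto simp: coeff_eq_0)
  then have "(\<Sum>i\<in>J. poly ?l (x i) * w i) = (\<Sum>i\<in>J. \<Sum>s<card J. poly.coeff ?l s * (x i ^ s * w i))"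
    by (simp add: sum_distrib_right mult.assoc)
  also have "\<dots> = (\<Sum>s<card J. poly.coeff ?l s * (\<Sum>i\<in>J. x i ^ s * w i))"
    by (subst sum.swap) (simp add: sum_distrib_left)
  also have "\<dots> = 0"
    using sums by simp
  finally have "(\<Sum>i\<in>J. (if i = j then 1 else 0) * w i) = 0"
    using assms by (simp add: poly_lagrange_basis cong: sum.cong)
  then show ?thesis
    using assms by (simp flip: of_bool_def)
qed

section \<open>Subfields of a finite field\<close>

text \<open>Multiplication by a nonzero \<open>x\<close> permutes the nonzero elements of
  \<open>E\<close>; comparing the products of all of them gives
  \<open>x ^ (card E - 1) = 1\<close>.\<close>

lemma power_card_subfield:
  fixes x :: "'a::{field,finite}"
  assumes E: "is_subfield E" and x: "x \<in> E"
  shows "x ^ card E = x"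
proof (cases "x = 0")
  case False
  have *: "x * y \<in> E" "y / x \<in> E" if "y \<in> E" for y
    using E x that by (auto simp: is_subfield_def divide_inverse)
  have "0 \<in> E" using E by (simp add: is_subfield_def)
  then have "card E > 0" by (auto simp: card_gt_0_iff)
  have "(\<Prod>y\<in>E - {0}. y) = (\<Prod>y\<in>E - {0}. x * y)"
    by (rule prod.reindex_bij_witness[of _ "\<lambda>y. x * y" "\<lambda>y. y / x"]) (use False * in auto)
  also have "\<dots> = x ^ (card E - 1) * (\<Prod>y\<in>E - {0}. y)"
    using \<open>0 \<in> E\<close> by (simp add: prod.distrib)
  finally have "x ^ (card E - 1) = 1"
    by simp
  moreover have "x ^ card E = x * x ^ (card E - 1)"
    using \<open>card E > 0\<close> by (metis Suc_diff_1 power_Suc)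
  ultimately show ?thesis by simp
next
  case True
  have "0 \<in> E" using E by (simp add: is_subfield_def)
  then have "card E > 0" by (auto simp: card_gt_0_iff)
  then show ?thesis using True by simp
qed

lemma is_subfield_UNIV: "is_subfield UNIV"
  by (simp add: is_subfield_def)

lemma two_le_card_subfield:
  fixes E :: "'a::{field,finite} set"
  assumes "is_subfield E"
  shows "2 \<le> card E"
proof -
  have "{0, 1} \<subseteq> E" using assms by (simp add: is_subfield_def)
  then have "card {0, 1 :: 'a} \<le> card E" by (intro card_mono) auto
  then show ?thesis by simp
qed

text \<open>The fixed points are the roots of \<open>X ^ n - X\<close>, whose leading term is
  \<open>X ^ n\<close> because \<open>n \<ge> 2\<close>.\<close>

lemma card_power_fixed_le:
  assumes "n \<ge> 2"
  shows "card {x :: 'a::{field,finite}. x ^ n = x} \<le> n"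
proof -
  define g :: "'a poly" where "g = monom 1 n - [:0, 1:]"
  have "degree ([:0, 1:] :: 'a poly) < degree (monom 1 n :: 'a poly)"
    using assms by (simp add: degree_monom_eq)
  then have "degree g = n"
    by (simp only: g_def diff_conv_add_uminus degree_minus degree_add_eq_left)
      (simp add: degree_monom_eq)
  moreover have "g \<noteq> 0"
    using \<open>degree g = n\<close> assms by auto
  ultimately show ?thesis
    using card_poly_roots_bound[of g] by (simp add: g_def poly_monom)
qed

text \<open>\<open>E\<close> lies among the fixed points, and there are at most
  \<open>card E\<close> of these. Hence a subfield is determined by its cardinality.\<close>

lemma subfield_eq_power_fixed:
  fixes E :: "'a::{field,finite} set"
  assumes E: "is_subfield E"
  shows "E = {x. x ^ card E = x}"
proof (rule card_subset_eq)
  show sub: "E \<subseteq> {x. x ^ card E = x}"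
    using power_card_subfield[OF E] by auto
  have "card E \<le> card {x :: 'a. x ^ card E = x}"
    using sub by (intro card_mono) auto
  then show "card E = card {x :: 'a. x ^ card E = x}"
    using card_power_fixed_le[OF two_le_card_subfield[OF E], where ?'a = 'a] by simp
qed simp

text \<open>All \<open>n ^ d - 1\<close> nonzero elements are roots of \<open>X ^ (n ^ d - 1) - 1\<close>; its cofactor over
  \<open>X ^ (n - 1) - 1\<close> has degree \<open>n ^ d - n\<close>, so it cannot absorb more roots than that.\<close>

lemma card_power_fixed:
  assumes card: "CARD('a::{field,finite}) = n ^ d" and n: "n \<ge> 2" and d: "d > 0"
  shows "card {x :: 'a. x ^ n = x} = n"
proof (rule order.antisym)
  show "card {x :: 'a. x ^ n = x} \<le> n"
    by (rule card_power_fixed_le[OF n])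
  define m where "m = n - 1"
  define e where "e = (\<Sum>i<d. n ^ i)"
  have m: "m > 0" "n = Suc m" using n by (auto simp: m_def)
  \<comment> \<open>The factorisation is taken over \<open>int\<close> because subtraction on
    \<open>nat\<close> truncates.\<close>
  have "int n ^ d - 1 = (int n - 1) * (\<Sum>i<d. int n ^ i)"
    by (rule power_diff_1_eq)
  moreover have "int n - 1 = int m"
    using m by simp
  ultimately have "int (n ^ d) = int (m * e + 1)"
    by (simp add: e_def algebra_simps)
  then have nd: "n ^ d = m * e + 1" by linarith
  have e: "e > 0"
    unfolding e_def by (rule sum_pos2[of _ 0]) (use d in auto)
  define g :: "'a poly" where "g = (\<Sum>k<e. monom 1 (m * k))"
  have "degree g \<le> m * (e - 1)"
    unfolding g_def by (rule degree_sum_le) (auto intro!: order_trans[OF degree_monom_le])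
  \<comment> \<open>Only the term with \<open>k = 0\<close> survives at 0; this shows
    \<open>g \<noteq> 0\<close> and makes the root bound available.\<close>
  moreover have "poly g 0 = 1"
  proof -
    have "poly g 0 = (\<Sum>k<e. if k = 0 then 1 else 0)"
      using m by (auto simp: g_def poly_sum poly_monom power_0_left intro!: sum.cong)
    then show ?thesis using e by simp
  qed
  then have "g \<noteq> 0" by auto
  ultimately have roots_g: "card {x. poly g x = 0} \<le> m * (e - 1)"
    using card_poly_roots_bound[of g] by linarith
  define U where "U = {x :: 'a. x \<noteq> 0 \<and> x ^ m = 1}"
  have "UNIV - {0} \<subseteq> U \<union> {x. poly g x = 0}"
  proof
    fix x :: 'a assume "x \<in> UNIV - {0}"
    then have x: "x \<noteq> 0" by simp
    have "x ^ (m * e + 1) = x"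
      using power_card_subfield[OF is_subfield_UNIV, of x] card nd by simp
    then have "(x ^ m) ^ e = 1" using x by (simp add: power_mult)
    moreover have "(x ^ m) ^ e - 1 = (x ^ m - 1) * (\<Sum>k<e. (x ^ m) ^ k)"
      by (rule power_diff_1_eq)
    moreover have "(\<Sum>k<e. (x ^ m) ^ k) = poly g x"
      by (simp add: g_def poly_sum poly_monom power_mult)
    ultimately show "x \<in> U \<union> {x. poly g x = 0}" using x by (auto simp: U_def)
  qed
  then have "card (UNIV - {0 :: 'a}) \<le> card (U \<union> {x. poly g x = 0})"
    by (intro card_mono) auto
  also have "\<dots> \<le> card U + card {x. poly g x = 0}"
    by (rule card_Un_le)
  finally have "m * e \<le> card U + m * (e - 1)"
    using roots_g card nd by (simp add: card_Diff_singleton)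
  moreover have "m * e = m + m * (e - 1)"
    using e by (metis Suc_diff_1 mult_Suc_right)
  ultimately have "m \<le> card U" by linarith
  moreover have "card (insert 0 U) \<le> card {x :: 'a. x ^ n = x}"
    by (rule card_mono) (use m in \<open>auto simp: U_def\<close>)
  moreover have "card (insert 0 U) = card U + 1"
    by (simp add: U_def)
  ultimately show "n \<le> card {x :: 'a. x ^ n = x}" using m by linarith
qed

section \<open>Characteristic and Frobenius maps\<close>

lemma prime_CHAR_finite_field: "prime CHAR('a::{field,finite})"
  using prime_CHAR_semidom[where ?'a = 'a] finite_imp_CHAR_pos[where ?'a = 'a] by simp

text \<open>Translation by 1 permutes the field, so summing all elements shows that
  \<open>CARD('a)\<close> is 0 in the field; the characteristic is thus a prime dividing
  \<open>r ^ k\<close>.\<close>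

lemma CHAR_eq_if_card_prime_power:
  assumes "CARD('a::{field,finite}) = r ^ k" "prime r"
  shows "CHAR('a) = r"
proof -
  have "(\<Sum>x\<in>UNIV. x :: 'a) = (\<Sum>x\<in>UNIV. x + 1)"
    by (rule sum.reindex_bij_witness[of _ "\<lambda>x. x + 1" "\<lambda>x. x - 1"]) auto
  then have "of_nat CARD('a) = (0 :: 'a)"
    by (simp add: sum.distrib)
  then have "CHAR('a) dvd r ^ k"
    using assms by (simp only: of_nat_eq_0_iff_char_dvd)
  then show ?thesis
    using assms prime_CHAR_finite_field[where ?'a = 'a]
    by (metis prime_dvd_power primes_dvd_imp_eq)
qed

text \<open>For a power \<open>n\<close> of the characteristic, \<open>x ^ n\<close> is additive as
  well as multiplicative in \<open>x\<close>.\<close>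

lemma is_subfield_power_fixed:
  assumes n: "n = CHAR('a::{field,finite}) ^ k"
  shows "is_subfield {x :: 'a. x ^ n = x}"
proof -
  have add: "(x + y) ^ n = x ^ n + y ^ n" for x y :: 'a
    using freshmans_dream'[OF prime_CHAR_finite_field n] .
  have "n > 0" using n prime_gt_0_nat[OF prime_CHAR_finite_field[where ?'a = 'a]] by simp
  \<comment> \<open>Additivity applied to \<open>x + (- x) = 0\<close> covers even and odd
    characteristic alike.\<close>
  have "(- x) ^ n = - (x ^ n)" for x :: 'a
    using add[of x "- x"] \<open>n > 0\<close> by (simp add: eq_neg_iff_add_eq_0 add.commute power_0_left)
  then show ?thesis
    using \<open>n > 0\<close> by (auto simp: is_subfield_def add power_mult_distrib power_inverse)
qed

section \<open>Generated subfields and extension degrees\<close>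

lemma is_subfield_gen_field: "is_subfield (gen_field S)"
  unfolding gen_field_def is_subfield_def by auto

lemma gen_field_superset: "S \<subseteq> gen_field S"
  unfolding gen_field_def by auto

lemma gen_field_minimal: "is_subfield K \<Longrightarrow> S \<subseteq> K \<Longrightarrow> gen_field S \<subseteq> K"
  unfolding gen_field_def by auto

text \<open>\<open>E\<close> is a vector space over \<open>K\<close>. In place of a basis, the proof
  takes a largest \<open>K\<close>-subspace whose size is a power of \<open>card K\<close>;
  adjoining a further element would multiply its size by \<open>card K\<close>, so it is all of
  \<open>E\<close>.\<close>

lemma card_subfield_extension:
  fixes K E :: "'a::{field,finite} set"
  assumes K: "is_subfield K" and E: "is_subfield E" and sub: "K \<subseteq> E"
  obtains d where "card E = card K ^ d"
proof -
  define subspace where "subspace V \<longleftrightarrow> 0 \<in> V \<and> V \<subseteq> E \<and> (\<forall>x\<in>V. \<forall>y\<in>V. x - y \<in> V) \<and>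
    (\<forall>c\<in>K. \<forall>x\<in>V. c * x \<in> V) \<and> (\<exists>d. card V = card K ^ d)" for V
  have E_closed: "x - y \<in> E" "x * y \<in> E" if "x \<in> E" "y \<in> E" for x y
    using E that by (auto simp: is_subfield_def) (metis diff_conv_add_uminus)
  have K_closed: "x - y \<in> K" "x * y \<in> K" "inverse x \<in> K" if "x \<in> K" "y \<in> K" for x y
    using K that by (auto simp: is_subfield_def) (metis diff_conv_add_uminus)
  have "subspace {0}"
    using E by (auto simp: subspace_def is_subfield_def intro: exI[of _ 0])
  moreover have "\<forall>V. subspace V \<longrightarrow> card V < Suc (card (UNIV :: 'a set))"
    by (simp add: less_Suc_eq_le card_mono)
  ultimately obtain V where V: "subspace V" and max: "\<And>W. subspace W \<Longrightarrow> card W \<le> card V"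
    using ex_has_greatest_nat[of subspace "{0}" card "Suc (card (UNIV :: 'a set))"]
    by blast
  have "V = E"
  proof (rule ccontr)
    assume "V \<noteq> E"
    then obtain x where x: "x \<in> E" "x \<notin> V" using V by (auto simp: subspace_def)
    \<comment> \<open>\<open>W\<close> is the span of \<open>V\<close> and \<open>x\<close>. As
      \<open>x\<close> lies outside \<open>V\<close>, the representation \<open>v + c * x\<close> is
      unique, which gives the size of \<open>W\<close>.\<close>
    define W where "W = (\<lambda>(v, c). v + c * x) ` (V \<times> K)"
    have inj: "inj_on (\<lambda>(v, c). v + c * x) (V \<times> K)"
    proof (rule inj_onI, clarify)
      fix v c w e assume H: "v \<in> V" "c \<in> K" "w \<in> V" "e \<in> K" "v + c * x = w + e * x"
      have "c = e"
      proof (rule ccontr)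
        assume "c \<noteq> e"
        then have "x = inverse (c - e) * (w - v)"
          using H(5) by (simp add: field_simps)
        moreover have "inverse (c - e) \<in> K" "w - v \<in> V"
          using H K_closed V by (auto simp: subspace_def)
        ultimately have "x \<in> V" using V by (auto simp: subspace_def)
        then show False using x by simp
      qed
      then show "v = w \<and> c = e" using H by simp
    qed
    obtain d where "card V = card K ^ d" using V by (auto simp: subspace_def)
    then have card_W: "card W = card K ^ Suc d"
      unfolding W_def using inj by (simp add: card_image card_cartesian_product)
    have "subspace W"
      unfolding subspace_def
    proof (intro conjI ballI)
      have "0 \<in> V" "0 \<in> K" using V K by (auto simp: subspace_def is_subfield_def)
      then show "0 \<in> W" by (force simp: W_def)
      show "W \<subseteq> E"
      proof
        fix y assume "y \<in> W"
        then obtain v c where "v \<in> E" "c \<in> E" "y = v + c * x"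
          using V sub by (auto simp: W_def subspace_def)
        then show "y \<in> E" using E x by (auto simp: is_subfield_def)
      qed
    next
      fix y z assume "y \<in> W" "z \<in> W"
      then obtain v c w e where H: "v \<in> V" "c \<in> K" "w \<in> V" "e \<in> K" "y = v + c * x" "z = w + e * x"
        by (auto simp: W_def)
      then have "y - z = (v - w) + (c - e) * x" by (simp add: algebra_simps)
      moreover have "v - w \<in> V" "c - e \<in> K" using H V K_closed by (auto simp: subspace_def)
      ultimately show "y - z \<in> W" by (auto simp: W_def)
    next
      fix k y assume "k \<in> K" "y \<in> W"
      then obtain v c where H: "v \<in> V" "c \<in> K" "y = v + c * x" by (auto simp: W_def)
      then have "k * y = k * v + (k * c) * x" by (simp add: algebra_simps)
      moreover have "k * v \<in> V" "k * c \<in> K"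
        using H V K_closed \<open>k \<in> K\<close> by (auto simp: subspace_def)
      ultimately show "k * y \<in> W" by (auto simp: W_def)
    qed (use card_W in blast)
    then have "card W \<le> card V" by (rule max)
    moreover have "card V < card W"
      using \<open>card V = card K ^ d\<close> card_W two_le_card_subfield[OF K] by simp
    ultimately show False by simp
  qed
  then show ?thesis using V that by (auto simp: subspace_def)
qed

lemma power_power_fixed:
  fixes x :: "'a::monoid_mult"
  shows "x ^ n = x \<Longrightarrow> x ^ (n ^ k) = x"
  by (induction k) (simp_all add: power_mult)

text \<open>With the Bezout identity \<open>a * u = b * v + 1\<close>, iterating the first equation
  \<open>u\<close> times and the second \<open>v\<close> times leaves a single \<open>n\<close>-th
  power.\<close>

lemma power_fixed_coprime:
  fixes x :: "'a::monoid_mult"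
  assumes "x ^ (n ^ a) = x" "x ^ (n ^ b) = x" "coprime a b" "a > 0"
  shows "x ^ n = x"
proof -
  obtain u v where uv: "a * u = b * v + 1"
    using bezout_nat[of a b] assms(3,4) by auto
  have "x = x ^ (n ^ (a * u))"
    using power_power_fixed[OF assms(1), of u] by (simp add: power_mult)
  also have "\<dots> = (x ^ (n ^ (b * v))) ^ n"
    by (simp add: uv mult.commute flip: power_mult)
  also have "x ^ (n ^ (b * v)) = x"
    using power_power_fixed[OF assms(2), of v] by (simp add: power_mult)
  finally show ?thesis by simp
qed

text \<open>A base of at least 2 makes the exponent unique, which resolves the \<open>THE\<close> in
  \<open>field_degree\<close>.\<close>

lemma field_degree_eqI:
  assumes "card E = card K ^ d" "card K \<ge> 2"
  shows "field_degree K E = d"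
  unfolding field_degree_def using assms by (intro the_equality) auto

text \<open>The \<open>THE\<close> in \<open>base_field\<close> is resolved by the fixed points of
  \<open>x ^ q\<close>: they form a subfield of the right size, and every subfield of that size
  equals them.\<close>

lemma base_field_eq:
  assumes "CARD('a::{field,finite}) = q ^ m" "q = CHAR('a) ^ k" "q \<ge> 2" "m > 0"
  shows "base_field q = {x :: 'a. x ^ q = x}"
    and "is_subfield (base_field q :: 'a set)"
    and "card (base_field q :: 'a set) = q"
proof -
  show eq: "base_field q = {x :: 'a. x ^ q = x}"
    unfolding base_field_def
  proof (rule the_equality)
    show "is_subfield {x :: 'a. x ^ q = x} \<and> card {x :: 'a. x ^ q = x} = q"
      using is_subfield_power_fixed[OF assms(2)] card_power_fixed[OF assms(1,3,4)] by simp
    fix K :: "'a set" assume "is_subfield K \<and> card K = q"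
    then show "K = {x. x ^ q = x}" using subfield_eq_power_fixed[of K] by simp
  qed
  show "is_subfield (base_field q :: 'a set)" "card (base_field q :: 'a set) = q"
    unfolding eq using is_subfield_power_fixed[OF assms(2)] card_power_fixed[OF assms(1,3,4)]
    by simp_all
qed

lemma prod_distinct_primes_dvd:
  fixes p :: "'i \<Rightarrow> nat"
  assumes "finite J" "inj_on p J" "\<And>j. j \<in> J \<Longrightarrow> prime (p j)" "\<And>j. j \<in> J \<Longrightarrow> p j dvd n"
  shows "prod p J dvd n"
  using assms
proof (induction J)
  case (insert j J)
  have "coprime (p j) (p i)" if "i \<in> J" for i
    using insert that by (intro primes_coprime) (auto simp: inj_on_def)
  then have "coprime (p j) (prod p J)"
    by (rule prod_coprime_right)
  then show ?case
    using insert by (auto intro!: divides_mult)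
qed simp

section \<open>The node fields of the code\<close>

text \<open>These are the hypotheses that do not mention nodes, so the existence of nodes and the
  rate are proved without any choice of \<open>\<alpha>\<close>.\<close>

locale ftp_params =
  fixes L T q0 :: nat and p :: "nat \<Rightarrow> nat" and field_type :: "'a::{field,finite} itself"
  assumes L_pos: "L > 0" and T_pos: "T > 0"
    and p_prime: "\<And>i. i \<in> {1..L} \<Longrightarrow> prime (p i)"
    and p_mono: "\<And>i j. i \<in> {1..L} \<Longrightarrow> j \<in> {1..L} \<Longrightarrow> i < j \<Longrightarrow> p i < p j"
    and q0_pp: "\<exists>r k. prime r \<and> k > 0 \<and> q0 = r ^ k"
    and q0_ge: "q0 \<ge> ftp_N p L T L"
    and card_q: "CARD('a) = q0 ^ (\<Prod>i\<in>{1..L}. p i)"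
begin

abbreviation K :: "'a set" where "K \<equiv> base_field q0"

lemma p_pos: "i \<in> {1..L} \<Longrightarrow> p i > 0"
  using p_prime prime_gt_0_nat by blast

lemma inj_on_p: "inj_on p {1..L}"
  by (rule linorder_inj_onI) (use p_mono in \<open>auto dest: less_imp_neq\<close>)

lemma prod_p_pos: "(\<Prod>i\<in>{1..L}. p i) > 0"
  using p_pos by (intro prod_pos) auto

lemma prod_p_split: "i \<in> {1..L} \<Longrightarrow> (\<Prod>j\<in>{1..L}. p j) = p i * (\<Prod>j\<in>{1..L} - {i}. p j)"
  by (rule prod.remove) auto

lemma q0_ge_2: "q0 \<ge> 2"
proof -
  obtain r k where rk: "prime r" "k > 0" "q0 = r ^ k" using q0_pp by blast
  then show ?thesis
    using prime_ge_2_nat[OF rk(1)] self_le_power[of r k] by simp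
qed

lemma q0_CHAR: obtains k where "q0 = CHAR('a) ^ k"
proof -
  obtain r k where "prime r" "q0 = r ^ k" using q0_pp by blast
  moreover from this have "CARD('a) = r ^ (k * (\<Prod>i\<in>{1..L}. p i))"
    using card_q by (simp add: power_mult)
  ultimately show ?thesis
    using CHAR_eq_if_card_prime_power[of r "k * (\<Prod>i\<in>{1..L}. p i)", where ?'a = 'a] that by blast
qed

lemma K_eq: "K = {x. x ^ q0 = x}" and is_subfield_K: "is_subfield K" and card_K: "card K = q0"
proof -
  obtain k where "q0 = CHAR('a) ^ k" by (rule q0_CHAR)
  from base_field_eq[OF card_q this q0_ge_2 prod_p_pos]
  show "K = {x. x ^ q0 = x}" "is_subfield K" "card K = q0" by auto
qed

lemma is_subfield_fixed: "is_subfield {x :: 'a. x ^ (q0 ^ d) = x}"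
proof -
  obtain k where "q0 = CHAR('a) ^ k" by (rule q0_CHAR)
  then have "q0 ^ d = CHAR('a) ^ (k * d)" by (simp add: power_mult)
  then show ?thesis by (rule is_subfield_power_fixed)
qed

lemma add_power_q0: "(x + y :: 'a) ^ (q0 ^ d) = x ^ (q0 ^ d) + y ^ (q0 ^ d)"
proof -
  obtain k where "q0 = CHAR('a) ^ k" by (rule q0_CHAR)
  then have "q0 ^ d = CHAR('a) ^ (k * d)" by (simp add: power_mult)
  then show ?thesis by (intro freshmans_dream'[OF prime_CHAR_finite_field])
qed

text \<open>As \<open>d\<close> divides the total degree, \<open>CARD('a)\<close> is a power of
  \<open>q0 ^ d\<close>; the fixed points are the intermediate field of degree \<open>d\<close> over
  \<open>K\<close>.\<close>

lemma card_fixed: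
  assumes "d * e = (\<Prod>i\<in>{1..L}. p i)"
  shows "card {x :: 'a. x ^ (q0 ^ d) = x} = q0 ^ d"
proof (rule card_power_fixed)
  show "CARD('a) = (q0 ^ d) ^ e"
    using card_q assms by (simp flip: power_mult)
  have "d > 0" "e > 0" using assms prod_p_pos by (metis mult_0 mult_0_right not_gr_zero)+
  then show "q0 ^ d \<ge> 2" "e > 0"
    using q0_ge_2 self_le_power[of q0 d] by auto
qed

lemma card_eq_q0_power:
  assumes "is_subfield E" "K \<subseteq> E"
  shows "card E = q0 ^ field_degree K E"
proof -
  obtain d where d: "card E = card K ^ d"
    using card_subfield_extension[OF is_subfield_K assms] .
  then have "field_degree K E = d"
    using card_K q0_ge_2 by (intro field_degree_eqI) auto
  then show ?thesis using d card_K by simp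
qed

text \<open>A cardinality form of the tower law: \<open>card F\<close> is a power of
  \<open>card E\<close>, and exponents of \<open>q0\<close> are compared.\<close>

lemma degree_dvd:
  fixes E F :: "'a set"
  assumes "is_subfield E" "is_subfield F" "E \<subseteq> F" "card E = q0 ^ d" "card F = q0 ^ e"
  shows "d dvd e"
proof -
  obtain k where "card F = card E ^ k"
    using card_subfield_extension[OF assms(1-3)] .
  then have "q0 ^ e = q0 ^ (d * k)" using assms by (simp add: power_mult)
  then have "e = d * k" using q0_ge_2 by (subst (asm) power_inject_exp) auto
  then show ?thesis by simp
qed

lemma fixed_mono: "d dvd e \<Longrightarrow> x ^ (q0 ^ d) = x \<Longrightarrow> x ^ (q0 ^ e) = (x :: 'a)"
  by (auto simp: power_mult power_power_fixed elim!: dvdE)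

text \<open>In the subfield of degree \<open>p i\<close> over \<open>K\<close>, every
  \<open>x\<close> outside \<open>K\<close> is a generator: the degree of the field it generates
  divides the prime \<open>p i\<close> and is not 1.\<close>

lemma ex_nodes: "\<exists>\<alpha> :: nat \<Rightarrow> 'a. ftp_nodes q0 L T p \<alpha>"
proof -
  have "\<exists>x :: 'a. field_degree K (gen_field (K \<union> {x})) = p i" if i: "i \<in> {1..L}" for i
  proof -
    define F where "F = {x :: 'a. x ^ (q0 ^ p i) = x}"
    have F: "is_subfield F" "card F = q0 ^ p i"
      using is_subfield_fixed card_fixed prod_p_split[OF i] by (auto simp: F_def)
    have KF: "K \<subseteq> F" using fixed_mono[of 1 "p i"] by (auto simp: K_eq F_def)
    have "p i > 1" using p_prime[OF i] prime_gt_1_nat by blast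
    then have "card K < card F"
      using F(2) card_K q0_ge_2 power_strict_increasing[of 1 "p i" q0] by simp
    then obtain x where x: "x \<in> F" "x \<notin> K" using KF by (metis less_irrefl subsetI subset_antisym)
    define E where "E = gen_field (K \<union> {x})"
    have E: "is_subfield E" "K \<union> {x} \<subseteq> E" "E \<subseteq> F"
      unfolding E_def
      using is_subfield_gen_field gen_field_superset[of "K \<union> {x}"] gen_field_minimal[OF F(1), of "K \<union> {x}"] KF x
      by auto
    have card_E: "card E = q0 ^ field_degree K E" using E card_eq_q0_power by auto
    then have "field_degree K E dvd p i" using degree_dvd[OF E(1) F(1) E(3)] F(2) by auto
    then have "field_degree K E = 1 \<or> field_degree K E = p i"
      using p_prime[OF i] by (simp add: prime_nat_iff)
    moreover have "field_degree K E \<noteq> 1"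
    proof
      assume "field_degree K E = 1"
      then have "card K = card E" using card_E card_K by simp
      then have "K = E" using E(2) by (intro card_subset_eq) auto
      then show False using E(2) x by auto
    qed
    ultimately show ?thesis by (auto simp: E_def)
  qed
  then obtain \<beta> :: "nat \<Rightarrow> 'a" where
    \<beta>: "\<And>i. i \<in> {1..L} \<Longrightarrow> field_degree K (gen_field (K \<union> {\<beta> i})) = p i"
    by metis
  \<comment> \<open>Here the lower bound on \<open>q0\<close> enters: the server nodes must be
    distinct elements of \<open>K\<close>.\<close>
  have "card {L+1..ftp_N p L T L + L} \<le> card K"
    using q0_ge card_K by simp
  then obtain \<gamma> where \<gamma>: "\<gamma> ` {L+1..ftp_N p L T L + L} \<subseteq> K" "inj_on \<gamma> {L+1..ftp_N p L T L + L}"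
    using card_le_inj[of "{L+1..ftp_N p L T L + L}" K] by auto
  define \<alpha> where "\<alpha> j = (if j \<le> L then \<beta> j else \<gamma> j)" for j
  have "ftp_nodes q0 L T p \<alpha>"
    unfolding ftp_nodes_def
  proof (intro conjI ballI)
    show "inj_on \<alpha> {L+1..ftp_N p L T L + L}"
      using \<gamma>(2) by (auto simp: inj_on_def \<alpha>_def)
  qed (use \<beta> \<gamma>(1) in \<open>auto simp: \<alpha>_def\<close>)
  then show ?thesis by blast
qed

end

section \<open>Degrees and distinctness for a given choice of nodes\<close>

locale ftp_code = ftp_params L T q0 p field_type
  for L T q0 :: nat and p and field_type :: "'a::{field,finite} itself" +
  fixes \<alpha> :: "nat \<Rightarrow> 'a"
  assumes nodes: "ftp_nodes q0 L T p \<alpha>"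
begin

abbreviation n :: nat where "n \<equiv> ftp_N p L T L + L"
abbreviation Q :: "nat \<Rightarrow> nat" where "Q i \<equiv> q0 ^ (\<Prod>j\<in>{1..L} - {i}. p j)"
abbreviation F :: "nat \<Rightarrow> 'a set" where "F \<equiv> ftp_F q0 L \<alpha>"

lemma node_in_K: "j \<in> {L+1..n} \<Longrightarrow> \<alpha> j \<in> K"
  using nodes by (simp add: ftp_nodes_def)

lemma card_simple_extension:
  assumes "i \<in> {1..L}"
  shows "card (gen_field (K \<union> {\<alpha> i})) = q0 ^ p i"
proof -
  have "card (gen_field (K \<union> {\<alpha> i})) = q0 ^ field_degree K (gen_field (K \<union> {\<alpha> i}))"
    using gen_field_superset[of "K \<union> {\<alpha> i}"]
    by (intro card_eq_q0_power is_subfield_gen_field) auto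
  then show ?thesis using nodes assms by (simp add: ftp_nodes_def)
qed

lemma node_fixed:
  assumes "i \<in> {1..L}"
  shows "\<alpha> i ^ (q0 ^ p i) = \<alpha> i"
proof -
  have "\<alpha> i \<in> gen_field (K \<union> {\<alpha> i})"
    using gen_field_superset by blast
  from power_card_subfield[OF is_subfield_gen_field this] show ?thesis
    using card_simple_extension[OF assms] by simp
qed

text \<open>Otherwise the field generated by the node would have degree 1 over \<open>K\<close>,
  which is not prime.\<close>

lemma node_notin_K:
  assumes "i \<in> {1..L}"
  shows "\<alpha> i \<notin> K"
proof
  assume "\<alpha> i \<in> K"
  then have "gen_field (K \<union> {\<alpha> i}) \<subseteq> K"
    by (intro gen_field_minimal is_subfield_K) auto
  then have "card (gen_field (K \<union> {\<alpha> i})) \<le> card K"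
    by (intro card_mono) auto
  then have "q0 ^ p i \<le> q0 ^ 1"
    using card_simple_extension[OF assms] card_K by simp
  then have "p i \<le> 1"
    using q0_ge_2 by (subst (asm) power_increasing_iff) auto
  then show False using p_prime[OF assms] prime_gt_1_nat by (metis not_le)
qed

text \<open>Two of the first \<open>L\<close> nodes generate fields of different sizes, since their
  primes differ. The server nodes lie in \<open>K\<close>, which contains none of the first
  \<open>L\<close> nodes, and are distinct by \<open>ftp_nodes\<close>.\<close>

lemma inj_on_nodes: "inj_on \<alpha> {1..n}"
proof (rule linorder_inj_onI)
  fix i j assume ij: "i < j" "i \<in> {1..n}" "j \<in> {1..n}"
  consider "j \<le> L" | "i \<le> L" "j > L" | "i > L" using ij by linarith
  then show "\<alpha> i \<noteq> \<alpha> j"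
  proof cases
    case 1
    show ?thesis
    proof
      assume "\<alpha> i = \<alpha> j"
      then have "q0 ^ p i = q0 ^ p j"
        using card_simple_extension[of i] card_simple_extension[of j] ij 1 by simp
      then have "p i = p j" using q0_ge_2 by (subst (asm) power_inject_exp) auto
      then show False using p_mono[of i j] ij 1 by auto
    qed
  next
    case 2
    then show ?thesis using node_notin_K[of i] node_in_K[of j] ij by auto
  next
    case 3
    moreover have "inj_on \<alpha> {L+1..n}" using nodes by (simp add: ftp_nodes_def)
    ultimately show ?thesis using inj_onD[of \<alpha> "{L+1..n}" i j] ij by auto
  qed
qed auto

lemma is_subfield_F: "is_subfield (F i)"
  by (simp add: ftp_F_def is_subfield_gen_field)

lemma K_subset_F: "K \<subseteq> F i"
  using gen_field_superset by (fastforce simp: ftp_F_def)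

text \<open>The size is squeezed. All generators are fixed by the power \<open>Q i\<close>, which
  bounds it from above; and \<open>F i\<close> contains an extension of degree \<open>p j\<close>
  for each \<open>j \<noteq> i\<close> in \<open>{1..L}\<close>, so its degree is divisible by the
  product of these distinct primes.\<close>

lemma card_F: "card (F i) = Q i"
proof -
  let ?P = "\<Prod>j\<in>{1..L} - {i}. p j"
  have sub: "F i \<subseteq> {x. x ^ Q i = x}"
    unfolding ftp_F_def
  proof (intro gen_field_minimal is_subfield_fixed Un_least image_subsetI)
    show "K \<subseteq> {x. x ^ Q i = x}"
      using fixed_mono[of 1 ?P] by (auto simp: K_eq)
    fix j assume "j \<in> {1..L} - {i}"
    then show "\<alpha> j \<in> {x. x ^ Q i = x}"
      using fixed_mono[OF dvd_prodI[of "{1..L} - {i}" j p]] node_fixed[of j] by auto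
  qed
  obtain d where d: "card (F i) = q0 ^ d"
    using card_eq_q0_power[OF is_subfield_F K_subset_F] by blast
  have "?P dvd d"
  proof (rule prod_distinct_primes_dvd)
    fix j assume j: "j \<in> {1..L} - {i}"
    then show "prime (p j)" using p_prime by simp
    have "gen_field (K \<union> {\<alpha> j}) \<subseteq> F i"
      using K_subset_F gen_field_superset[of "K \<union> \<alpha> ` ({1..L} - {i})"] j
      by (intro gen_field_minimal is_subfield_F) (auto simp: ftp_F_def)
    then show "p j dvd d"
      using degree_dvd[OF is_subfield_gen_field is_subfield_F] card_simple_extension[of j] j d by auto
  qed (use inj_on_p in \<open>auto intro: inj_on_subset\<close>)
  moreover have "d > 0"
    using d two_le_card_subfield[OF is_subfield_F, of i] by (cases d) auto
  ultimately have "?P \<le> d" by (rule dvd_imp_le)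
  then have ge: "Q i \<le> card (F i)"
    using d q0_ge_2 by (simp add: power_increasing)
  have "?P > 0" using p_pos by (intro prod_pos) auto
  then have "2 \<le> Q i" using q0_ge_2 self_le_power[of q0 ?P] by simp
  have "card (F i) \<le> card {x :: 'a. x ^ Q i = x}"
    using sub by (intro card_mono) auto
  also have "\<dots> \<le> Q i"
    by (rule card_power_fixed_le) fact
  finally show ?thesis using ge by simp
qed

section \<open>The trace to \<open>F i\<close> and the conjugates of
  \<open>\<alpha> i\<close>\<close>

lemma field_trace_F:
  assumes "i \<in> {1..L}"
  shows "field_trace (F i) x = (\<Sum>k<p i. x ^ (Q i ^ k))"
proof -
  have "field_degree (F i) UNIV = p i"
  proof (rule field_degree_eqI)
    show "CARD('a) = card (F i) ^ p i"
      using prod_p_split[OF assms] by (simp add: card_q card_F mult.commute flip: power_mult)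
  qed (rule two_le_card_subfield[OF is_subfield_F])
  then show ?thesis by (simp add: field_trace_def card_F)
qed

lemma Q_power: "Q i ^ k = q0 ^ ((\<Prod>j\<in>{1..L} - {i}. p j) * k)"
  by (simp add: power_mult)

lemma add_power_Q_power: "(x + y :: 'a) ^ (Q i ^ k) = x ^ (Q i ^ k) + y ^ (Q i ^ k)"
  unfolding Q_power by (rule add_power_q0)

lemma field_trace_add:
  "i \<in> {1..L} \<Longrightarrow> field_trace (F i) (x + y) = field_trace (F i) x + field_trace (F i) y"
  by (simp only: field_trace_F add_power_Q_power sum.distrib)

lemma field_trace_0: "i \<in> {1..L} \<Longrightarrow> field_trace (F i) 0 = 0"
  using field_trace_add[of i 0 0] by (metis add_0 add_cancel_left_right)

lemma field_trace_sum:
  "i \<in> {1..L} \<Longrightarrow> field_trace (F i) (\<Sum>j\<in>J. f j) = (\<Sum>j\<in>J. field_trace (F i) (f j))"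
  by (induction J rule: infinite_finite_induct) (simp_all add: field_trace_0 field_trace_add)

lemma field_trace_scale:
  assumes "i \<in> {1..L}" "c \<in> F i"
  shows "field_trace (F i) (c * x) = c * field_trace (F i) x"
proof -
  have "c ^ (Q i ^ k) = c" for k
    using power_card_subfield[OF is_subfield_F assms(2)] power_power_fixed[of c "Q i" k]
    by (simp only: card_F)
  then show ?thesis
    by (simp add: field_trace_F[OF assms(1)] power_mult_distrib sum_distrib_left)
qed

text \<open>A coincidence would make \<open>\<alpha> i\<close> fixed by the power
  \<open>q0 ^ (?P * m)\<close> with \<open>0 < m < p i\<close>. It is also fixed by
  \<open>q0 ^ p i\<close>, and the exponents are coprime, so \<open>\<alpha> i\<close> would lie in
  \<open>K\<close>.\<close>

lemma inj_on_conjugates: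
  assumes "i \<in> {1..L}"
  shows "inj_on (\<lambda>k. \<alpha> i ^ (Q i ^ k)) {..<p i}"
proof (rule linorder_inj_onI)
  fix k l assume kl: "k < l" "k \<in> {..<p i}" "l \<in> {..<p i}"
  let ?P = "\<Prod>j\<in>{1..L} - {i}. p j"
  show "\<alpha> i ^ (Q i ^ k) \<noteq> \<alpha> i ^ (Q i ^ l)"
  proof
    assume eq: "\<alpha> i ^ (Q i ^ k) = \<alpha> i ^ (Q i ^ l)"
    have frob: "(x ^ (q0 ^ u)) ^ (q0 ^ v) = x ^ (q0 ^ (u + v))" for x :: 'a and u v
      by (simp add: power_add power_mult)
    \<comment> \<open>Raising to the power \<open>q0 ^ (?P * (p i - l))\<close> sends the
      \<open>l\<close>-th conjugate back to \<open>\<alpha> i\<close> and the \<open>k\<close>-th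
      one to the exponent \<open>q0 ^ (?P * m)\<close>.\<close>
    define m where "m = k + (p i - l)"
    have "\<alpha> i = \<alpha> i ^ (q0 ^ (?P * p i))"
      using fixed_mono[of "p i" "?P * p i" "\<alpha> i"] node_fixed[OF assms] by simp
    also have "?P * p i = ?P * l + ?P * (p i - l)"
      using kl by (simp flip: add_mult_distrib2)
    also have "\<alpha> i ^ (q0 ^ (?P * l + ?P * (p i - l))) = (\<alpha> i ^ (q0 ^ (?P * k))) ^ (q0 ^ (?P * (p i - l)))"
      using eq by (simp only: Q_power frob[symmetric])
    also have "\<dots> = \<alpha> i ^ (q0 ^ (?P * m))"
      by (simp only: frob m_def add_mult_distrib2)
    finally have fixed: "\<alpha> i ^ (q0 ^ (?P * m)) = \<alpha> i" by simp
    have "coprime (p i) (?P * m)"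
    proof -
      have "coprime (p i) (p j)" if "j \<in> {1..L} - {i}" for j
        using that assms inj_onD[OF inj_on_p, of i j] by (intro primes_coprime p_prime) auto
      then have "coprime (p i) ?P"
        by (rule prod_coprime_right)
      moreover have "0 < m" "m < p i" using kl by (auto simp: m_def)
      then have "\<not> p i dvd m" by (auto dest: dvd_imp_le)
      then have "coprime (p i) m" using p_prime[OF assms] by (simp add: prime_imp_coprime)
      ultimately show ?thesis by simp
    qed
    then have "\<alpha> i ^ q0 = \<alpha> i"
      by (rule power_fixed_coprime[OF node_fixed[OF assms] fixed _ p_pos[OF assms]])
    then show False using node_notin_K[OF assms] by (simp add: K_eq)
  qed
qed auto

text \<open>Expanding the traces over the conjugates of \<open>\<alpha>\<^sub>i\<close> turns the hypothesis into a Vandermonde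
  system in the conjugates of \<open>z\<close>.\<close>

lemma eq_0_if_traces_eq_0:
  assumes i: "i \<in> {1..L}" and "\<And>s. s < p i \<Longrightarrow> field_trace (F i) (\<alpha> i ^ s * z) = 0"
  shows "z = 0"
proof -
  \<comment> \<open>\<open>z\<close> is its own conjugate number 0, written so as to match
    \<open>w\<close> at index 0.\<close>
  have "z ^ (Q i ^ 0) = 0"
  proof (rule eq_0_if_power_sums_eq_0[OF _ inj_on_conjugates[OF i], where w = "\<lambda>k. z ^ (Q i ^ k)"])
    fix s assume "s < card {..<p i}"
    then have "0 = (\<Sum>k<p i. (\<alpha> i ^ s * z) ^ (Q i ^ k))"
      using assms(2)[of s] by (simp add: field_trace_F[OF i])
    also have "\<dots> = (\<Sum>k<p i. (\<alpha> i ^ (Q i ^ k)) ^ s * z ^ (Q i ^ k))"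
      by (simp only: power_mult_distrib mult.commute flip: power_mult)
    finally show "(\<Sum>k<p i. (\<alpha> i ^ (Q i ^ k)) ^ s * z ^ (Q i ^ k)) = 0" by simp
  qed (use p_pos[OF i] in auto)
  then show ?thesis by simp
qed

end

section \<open>Matrices of polynomials\<close>

lemma eval_mat_carrier [simp]: "G \<in> carrier_mat nr nc \<Longrightarrow> eval_mat G x \<in> carrier_mat nr nc"
  by (simp add: eval_mat_def)

lemma eval_mat_index:
  "G \<in> carrier_mat nr nc \<Longrightarrow> r < nr \<Longrightarrow> s < nc \<Longrightarrow> eval_mat G x $$ (r, s) = poly (G $$ (r, s)) x"
  by (simp add: eval_mat_def)

lemma index_mult_mat_sum:
  assumes "G \<in> carrier_mat nr m" "H \<in> carrier_mat m nc" "r < nr" "s < nc"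
  shows "(G * H) $$ (r, s) = (\<Sum>t<m. G $$ (r, t) * H $$ (t, s))"
  using assms by (simp add: scalar_prod_def lessThan_atLeast0)

lemma eval_mat_mult_index:
  assumes "G \<in> carrier_mat nr m" "H \<in> carrier_mat m nc" "r < nr" "s < nc"
  shows "(eval_mat G x * eval_mat H x) $$ (r, s) = poly (\<Sum>t<m. G $$ (r, t) * H $$ (t, s)) x"
  using assms by (subst index_mult_mat_sum[where nr = nr and m = m and nc = nc])
    (auto simp: poly_sum eval_mat_index intro!: sum.cong)

lemma poly_mat_eqI:
  fixes G H :: "'a::field poly mat"
  assumes G: "G \<in> carrier_mat nr nc" "\<And>r s. r < nr \<Longrightarrow> s < nc \<Longrightarrow> degree (G $$ (r, s)) \<le> d"
    and H: "H \<in> carrier_mat nr nc" "\<And>r s. r < nr \<Longrightarrow> s < nc \<Longrightarrow> degree (H $$ (r, s)) \<le> d"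
    and X: "d < card X" "\<And>x. x \<in> X \<Longrightarrow> eval_mat G x = eval_mat H x"
  shows "G = H"
proof (rule eq_matI)
  fix r s assume "r < dim_row H" "s < dim_col H"
  then have rs: "r < nr" "s < nc" using H(1) by auto
  show "G $$ (r, s) = H $$ (r, s)"
  proof (rule poly_eqI_degree)
    fix x assume "x \<in> X"
    then show "poly (G $$ (r, s)) x = poly (H $$ (r, s)) x"
      using X(2)[of x] eval_mat_index[OF G(1) rs, of x] eval_mat_index[OF H(1) rs, of x] by simp
  next
    show "degree (G $$ (r, s)) < card X" "degree (H $$ (r, s)) < card X"
      using G(2) H(2) rs X(1) by (meson le_less_trans)+
  qed
qed (use G H in auto)

text \<open>This resolves the \<open>THE\<close> in \<open>interp_mat\<close>: existence is Lagrange
  interpolation in each entry, uniqueness holds because \<open>Suc d\<close> distinct nodes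
  determine a polynomial of degree at most \<open>d\<close>.\<close>

lemma interp_mat:
  fixes pts :: "('a::field \<times> 'a mat) list"
  assumes dist: "distinct (map fst pts)" and len: "length pts = Suc d"
    and pts: "\<And>x M. (x, M) \<in> set pts \<Longrightarrow> M \<in> carrier_mat nr nc"
  defines "G \<equiv> interp_mat nr nc d pts"
  shows "G \<in> carrier_mat nr nc"
    and "\<And>r s. r < nr \<Longrightarrow> s < nc \<Longrightarrow> degree (G $$ (r, s)) \<le> d"
    and "\<And>x M. (x, M) \<in> set pts \<Longrightarrow> eval_mat G x = M"
proof -
  define x where "x k = fst (pts ! k)" for k
  define M where "M k = snd (pts ! k)" for k
  have inj: "inj_on x {..<length pts}"
    using dist by (auto simp: inj_on_def x_def distinct_conv_nth)
  have M: "M k \<in> carrier_mat nr nc" if "k < length pts" for k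
    using pts[of "x k" "M k"] that by (simp add: x_def M_def)
  let ?P = "\<lambda>G. G \<in> carrier_mat nr nc \<and> (\<forall>r<nr. \<forall>s<nc. degree (G $$ (r, s)) \<le> d) \<and>
      (\<forall>(x, M) \<in> set pts. eval_mat G x = M)"
  define H where "H = Matrix.mat nr nc (\<lambda>(r, s). \<Sum>k<length pts.
      smult (M k $$ (r, s)) (lagrange_basis x {..<length pts} k))"
  have "?P H"
  proof (intro conjI allI impI ballI)
    show H: "H \<in> carrier_mat nr nc" by (simp add: H_def)
    {
      fix r s assume rs: "r < nr" "s < nc"
      show "degree (H $$ (r, s)) \<le> d"
      proof -
        have "degree (smult (M k $$ (r, s)) (lagrange_basis x {..<length pts} k)) \<le> d"
          if "k < length pts" for k
          using order_trans[OF degree_smult_le degree_lagrange_basis[of x "{..<length pts}" k]] that len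
          by simp
        then show ?thesis
          using rs by (auto simp: H_def intro!: degree_sum_le)
      qed
    }
    fix y assume "y \<in> set pts"
    then obtain i where i: "i < length pts" "y = (x i, M i)"
      by (auto simp: in_set_conv_nth x_def M_def)
    have "eval_mat H (x i) = M i"
    proof (rule eq_matI)
      fix r s assume "r < dim_row (M i)" "s < dim_col (M i)"
      then have rs: "r < nr" "s < nc" using M[OF i(1)] by auto
      have "eval_mat H (x i) $$ (r, s) = (\<Sum>k<length pts. M k $$ (r, s) *
          poly (lagrange_basis x {..<length pts} k) (x i))"
        using rs H by (simp add: eval_mat_index[OF H rs]) (simp add: H_def poly_sum)
      also have "\<dots> = (\<Sum>k<length pts. if i = k then M k $$ (r, s) else 0)"
        using i(1) inj by (intro sum.cong) (auto simp: poly_lagrange_basis)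
      finally show "eval_mat H (x i) $$ (r, s) = M i $$ (r, s)"
        using i(1) by simp
    qed (use H M[OF i(1)] in \<open>auto simp: eval_mat_def\<close>)
    then show "case y of (x, M) \<Rightarrow> eval_mat H x = M" using i by simp
  qed
  moreover have "G' = H" if "?P G'" for G'
  proof (rule poly_mat_eqI[where X = "fst ` set pts"])
    have "card (fst ` set pts) = length pts"
      using dist by (metis distinct_card length_map set_map)
    then show "d < card (fst ` set pts)" using len by simp
  qed (use that \<open>?P H\<close> in fastforce)+
  ultimately have "?P G"
    unfolding G_def interp_mat_def by (intro theI[of ?P H])
  then show "G \<in> carrier_mat nr nc" "\<And>r s. r < nr \<Longrightarrow> s < nc \<Longrightarrow> degree (G $$ (r, s)) \<le> d"
    "\<And>x M. (x, M) \<in> set pts \<Longrightarrow> eval_mat G x = M"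
    by auto
qed

lemma finite_carrier_mat: "finite (carrier_mat nr nc :: 'a::finite mat set)"
proof (rule finite_subset)
  show "finite (Matrix.mat nr nc ` (({..<nr} \<times> {..<nc}) \<rightarrow>\<^sub>E (UNIV :: 'a set)))"
    by (intro finite_imageI finite_PiE) auto
  show "carrier_mat nr nc \<subseteq> Matrix.mat nr nc ` (({..<nr} \<times> {..<nc}) \<rightarrow>\<^sub>E (UNIV :: 'a set))"
  proof
    fix A :: "'a mat" assume A: "A \<in> carrier_mat nr nc"
    show "A \<in> Matrix.mat nr nc ` (({..<nr} \<times> {..<nc}) \<rightarrow>\<^sub>E (UNIV :: 'a set))"
    proof (rule image_eqI)
      show "A = Matrix.mat nr nc (restrict (\<lambda>ij. A $$ ij) ({..<nr} \<times> {..<nc}))"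
        using A by (intro eq_matI) auto
    qed auto
  qed
qed

text \<open>The inner summation index is cut into \<open>L\<close> runs of length
  \<open>b div L\<close>, which is exact because \<open>L\<close> divides \<open>b\<close>.\<close>

lemma mult_eq_sum_blocks:
  fixes A B :: "'a::comm_ring_1 mat"
  assumes A: "A \<in> carrier_mat a b" and B: "B \<in> carrier_mat b c" and "L dvd b"
    and rs: "r < a" "s < c"
  shows "(A * B) $$ (r, s) = (\<Sum>i=1..L. (blockA L b A i * blockB L b B i) $$ (r, s))"
proof -
  let ?m = "b div L"
  have "(A * B) $$ (r, s) = (\<Sum>t<L * ?m. A $$ (r, t) * B $$ (t, s))"
    using index_mult_mat_sum[OF A B rs] \<open>L dvd b\<close> by simp
  also have "\<dots> = (\<Sum>i<L. \<Sum>t=i * ?m..<i * ?m + ?m. A $$ (r, t) * B $$ (t, s))"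
    by (rule sum.nat_group[symmetric])
  also have "\<dots> = (\<Sum>i<L. \<Sum>t<?m. A $$ (r, i * ?m + t) * B $$ (i * ?m + t, s))"
  proof (rule sum.cong)
    fix i
    show "(\<Sum>t=i * ?m..<i * ?m + ?m. A $$ (r, t) * B $$ (t, s))
        = (\<Sum>t<?m. A $$ (r, i * ?m + t) * B $$ (i * ?m + t, s))"
      by (rule sum.reindex_bij_witness[of _ "\<lambda>t. i * ?m + t" "\<lambda>t. t - i * ?m"]) auto
  qed simp
  also have "\<dots> = (\<Sum>i<L. (blockA L b A (Suc i) * blockB L b B (Suc i)) $$ (r, s))"
  proof (rule sum.cong)
    fix i
    show "(\<Sum>t<?m. A $$ (r, i * ?m + t) * B $$ (i * ?m + t, s))
        = (blockA L b A (Suc i) * blockB L b B (Suc i)) $$ (r, s)"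
      by (subst index_mult_mat_sum[where nr = a and m = ?m and nc = c])
        (use A B rs in \<open>auto simp: blockA_def blockB_def\<close>)
  qed simp
  \<comment> \<open>Blocks are numbered from 1, the grouped sum from 0.\<close>
  also have "\<dots> = (\<Sum>i=1..L. (blockA L b A i * blockB L b B i) $$ (r, s))"
    by (rule sum.reindex_bij_witness[of _ "\<lambda>i. i - 1" Suc]) auto
  finally show ?thesis .
qed

section \<open>Mutual information\<close>

lemma emeasure_pair_pmf_Times:
  "emeasure (measure_pmf (pair_pmf D V)) (A \<times> B) = emeasure (measure_pmf D) A * emeasure (measure_pmf V) B"
proof -
  have "emeasure (measure_pmf (pair_pmf D V)) (A \<times> B)
      = (\<integral>\<^sup>+z. indicator (A \<times> B) z \<partial>measure_pmf (pair_pmf D V))"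
    by simp
  also have "\<dots> = (\<integral>\<^sup>+x. \<integral>\<^sup>+y. indicator A x * indicator B y \<partial>measure_pmf V \<partial>measure_pmf D)"
    by (simp add: nn_integral_pair_pmf' indicator_times)
  also have "\<dots> = emeasure (measure_pmf D) A * emeasure (measure_pmf V) B"
    by (simp add: nn_integral_cmult nn_integral_multc)
  finally show ?thesis .
qed

text \<open>If \<open>g x\<close> maps \<open>U\<close> to the same law \<open>V\<close> for every
  \<open>x\<close> in the support, the joint law is the product of the marginals, and the mutual
  information is the divergence of a measure from itself.\<close>

lemma mutual_information_eq_0_if_conditional_constant:
  assumes V: "\<And>x. x \<in> set_pmf D \<Longrightarrow> map_pmf (g x) U = V"
  shows "prob_space.mutual_information (measure_pmf (pair_pmf D U)) b
     (count_space UNIV) (count_space UNIV) fst (\<lambda>(x, u). g x u) = 0"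
proof -
  let ?M = "pair_pmf D U" and ?Y = "\<lambda>(x, u). g x u"
  have joint: "map_pmf (\<lambda>z. (fst z, ?Y z)) ?M = pair_pmf D V"
  proof -
    have "map_pmf (\<lambda>z. (fst z, ?Y z)) ?M = bind_pmf D (\<lambda>x. map_pmf (Pair x) (map_pmf (g x) U))"
      by (simp add: pair_pmf_def map_bind_pmf map_pmf_def bind_assoc_pmf bind_return_pmf)
    also have "\<dots> = bind_pmf D (\<lambda>x. map_pmf (Pair x) V)"
      using V by (intro bind_pmf_cong) auto
    also have "\<dots> = pair_pmf D V"
      by (simp add: pair_pmf_def map_pmf_def)
    finally show ?thesis .
  qed
  have marg1: "distr (measure_pmf ?M) (count_space UNIV) fst = measure_pmf D"
    by (simp add: map_fst_pair_pmf flip: map_pmf_rep_eq)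
  have "map_pmf ?Y ?M = map_pmf snd (map_pmf (\<lambda>z. (fst z, ?Y z)) ?M)"
    by (simp add: map_pmf_comp)
  then have "map_pmf ?Y ?M = V"
    by (simp add: joint map_snd_pair_pmf)
  then have marg2: "distr (measure_pmf ?M) (count_space UNIV) ?Y = measure_pmf V"
    by (simp flip: map_pmf_rep_eq)
  \<comment> \<open>Mutual information lives on the product sigma-algebra, so the identity of pmfs
    \<open>joint\<close> is transferred to it by checking rectangles.\<close>
  have indep: "measure_pmf D \<Otimes>\<^sub>M measure_pmf V
      = distr (measure_pmf ?M) (count_space UNIV \<Otimes>\<^sub>M count_space UNIV) (\<lambda>z. (fst z, ?Y z))"
  proof (rule pair_measure_eqI)
    show "sigma_finite_measure (measure_pmf D)" "sigma_finite_measure (measure_pmf V)"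
      by unfold_locales
    show "sets (measure_pmf D \<Otimes>\<^sub>M measure_pmf V)
      = sets (distr (measure_pmf ?M) (count_space UNIV \<Otimes>\<^sub>M count_space UNIV) (\<lambda>z. (fst z, ?Y z)))"
      unfolding sets_distr by (intro sets_pair_measure_cong) auto
    fix A B assume "A \<in> sets (measure_pmf D)" "B \<in> sets (measure_pmf V)"
    have "emeasure (distr (measure_pmf ?M) (count_space UNIV \<Otimes>\<^sub>M count_space UNIV) (\<lambda>z. (fst z, ?Y z))) (A \<times> B)
      = emeasure (measure_pmf (map_pmf (\<lambda>z. (fst z, ?Y z)) ?M)) (A \<times> B)"
      by (subst emeasure_distr) (auto simp: space_pair_measure)
    then show "emeasure (measure_pmf D) A * emeasure (measure_pmf V) B
      = emeasure (distr (measure_pmf ?M) (count_space UNIV \<Otimes>\<^sub>M count_space UNIV) (\<lambda>z. (fst z, ?Y z))) (A \<times> B)"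
      by (simp add: joint emeasure_pair_pmf_Times)
  qed
  have "prob_space (measure_pmf D \<Otimes>\<^sub>M measure_pmf V)"
    by (intro prob_space_pair prob_space_measure_pmf)
  then interpret DV: prob_space "measure_pmf D \<Otimes>\<^sub>M measure_pmf V" .
  show ?thesis
    unfolding prob_space.mutual_information_def[OF prob_space_measure_pmf] marg1 marg2 indep[symmetric]
    by (rule DV.KL_same_eq_0)
qed

section \<open>Security and decodability\<close>

context ftp_code
begin

abbreviation N :: "nat \<Rightarrow> nat" where "N \<equiv> ftp_N p L T"

lemma N_le: "i \<in> {1..L} \<Longrightarrow> N i \<le> N L"
  using p_mono[of i L] by (cases "i = L") (auto simp: ftp_N_def)

lemma L_T_le_n: "L + T \<le> n"
  using T_pos L_pos by (simp add: ftp_N_def)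

text \<open>A common form of \<open>ftp_f\<close> and \<open>ftp_g\<close>, with data blocks
  \<open>X\<close> and random blocks \<open>Z\<close>, so that each property is proved once for both
  factors.\<close>

definition interp :: "nat \<Rightarrow> nat \<Rightarrow> (nat \<Rightarrow> 'a mat) \<Rightarrow> 'a mat list \<Rightarrow> 'a poly mat" where
  "interp nr nc X Z = interp_mat nr nc (L + T - 1)
     (map (\<lambda>i. (\<alpha> i, X i)) [1..<L+1] @ map (\<lambda>j. (\<alpha> (L + j), Z ! (j - 1))) [1..<T+1])"

lemma ftp_f_eq_interp: "ftp_f L T \<alpha> a b A R = interp a (b div L) (blockA L b A) R"
  by (simp only: ftp_f_def interp_def)

lemma ftp_g_eq_interp: "ftp_g L T \<alpha> b c B S = interp (b div L) c (blockB L b B) S"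
  by (simp only: ftp_g_def interp_def)

lemma interp:
  assumes X: "\<And>i. X i \<in> carrier_mat nr nc"
    and Z: "length Z = T" "set Z \<subseteq> carrier_mat nr nc"
  shows "interp nr nc X Z \<in> carrier_mat nr nc"
    and "\<And>r s. r < nr \<Longrightarrow> s < nc \<Longrightarrow> degree (interp nr nc X Z $$ (r, s)) \<le> L + T - 1"
    and "\<And>i. i \<in> {1..L} \<Longrightarrow> eval_mat (interp nr nc X Z) (\<alpha> i) = X i"
    and "\<And>j. j \<in> {1..T} \<Longrightarrow> eval_mat (interp nr nc X Z) (\<alpha> (L + j)) = Z ! (j - 1)"
proof -
  let ?pts = "map (\<lambda>i. (\<alpha> i, X i)) [1..<L+1] @ map (\<lambda>j. (\<alpha> (L + j), Z ! (j - 1))) [1..<T+1]"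
  let ?is = "[1..<L+1] @ map ((+) L) [1..<T+1]"
  have "distinct ?is"
    by (auto simp: distinct_map simp del: upt_Suc)
  moreover have "set ?is \<subseteq> {1..n}"
    using L_T_le_n by (auto simp del: upt_Suc)
  then have "inj_on \<alpha> (set ?is)"
    by (rule inj_on_subset[OF inj_on_nodes])
  ultimately have "distinct (map \<alpha> ?is)"
    by (simp only: distinct_map)
  moreover have "map fst ?pts = map \<alpha> ?is"
    by (simp add: o_def del: upt_Suc)
  ultimately have dist: "distinct (map fst ?pts)"
    by (simp only:)
  \<comment> \<open>As \<open>L > 0\<close>, the truncated \<open>L + T - 1\<close> is the true
    predecessor of the number of points.\<close>
  have len: "length ?pts = Suc (L + T - 1)"
    using L_pos by simp
  have carr: "M \<in> carrier_mat nr nc" if "(x, M) \<in> set ?pts" for x M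
  proof -
    have "M \<in> X ` {1..L} \<or> M \<in> set Z"
      using that Z(1) by (auto simp del: upt_Suc)
    then show ?thesis using X Z(2) by auto
  qed
  show "interp nr nc X Z \<in> carrier_mat nr nc"
    unfolding interp_def by (rule interp_mat(1)[OF dist len carr])
  show "\<And>r s. r < nr \<Longrightarrow> s < nc \<Longrightarrow> degree (interp nr nc X Z $$ (r, s)) \<le> L + T - 1"
    unfolding interp_def by (rule interp_mat(2)[OF dist len carr])
  show "eval_mat (interp nr nc X Z) (\<alpha> i) = X i" if "i \<in> {1..L}" for i
    unfolding interp_def by (rule interp_mat(3)[OF dist len carr]) (use that in \<open>auto simp del: upt_Suc\<close>)
  show "eval_mat (interp nr nc X Z) (\<alpha> (L + j)) = Z ! (j - 1)" if "j \<in> {1..T}" for j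
    unfolding interp_def by (rule interp_mat(3)[OF dist len carr]) (use that in \<open>auto simp del: upt_Suc\<close>)
qed

text \<open>The data nodes and the nodes of \<open>Srv\<close> are \<open>L + T\<close> points,
  enough to determine entries of degree at most \<open>L + T - 1\<close>. The random blocks are then
  read off at the first \<open>T\<close> server nodes.\<close>

lemma interp_inj:
  assumes X: "\<And>i. X i \<in> carrier_mat nr nc"
    and Z: "length Z = T" "set Z \<subseteq> carrier_mat nr nc"
    and Z': "length Z' = T" "set Z' \<subseteq> carrier_mat nr nc"
    and Srv: "Srv \<subseteq> {1..N L}" "card Srv = T"
    and eq: "\<And>j. j \<in> Srv \<Longrightarrow> eval_mat (interp nr nc X Z) (\<alpha> (L + j)) = eval_mat (interp nr nc X Z') (\<alpha> (L + j))"
  shows "Z = Z'"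
proof -
  note I = interp[where X = X, OF X Z] and I' = interp[where X = X, OF X Z']
  have "interp nr nc X Z = interp nr nc X Z'"
  proof (rule poly_mat_eqI[where X = "\<alpha> ` ({1..L} \<union> (+) L ` Srv)"])
    have "inj_on \<alpha> ({1..L} \<union> (+) L ` Srv)"
      using Srv by (intro inj_on_subset[OF inj_on_nodes]) auto
    then have "card (\<alpha> ` ({1..L} \<union> (+) L ` Srv)) = card ({1..L} \<union> (+) L ` Srv)"
      by (rule card_image)
    also have "\<dots> = card {1..L} + card ((+) L ` Srv)"
      using Srv(1) finite_subset[OF Srv(1)] by (intro card_Un_disjoint) auto
    finally show "L + T - 1 < card (\<alpha> ` ({1..L} \<union> (+) L ` Srv))"
      using Srv L_pos by (simp add: card_image)
  next
    fix x assume "x \<in> \<alpha> ` ({1..L} \<union> (+) L ` Srv)"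
    then consider i where "i \<in> {1..L}" "x = \<alpha> i" | j where "j \<in> Srv" "x = \<alpha> (L + j)" by blast
    then show "eval_mat (interp nr nc X Z) x = eval_mat (interp nr nc X Z') x"
    proof cases
      case 1
      then show ?thesis using I(3)[OF 1(1)] I'(3)[OF 1(1)] by simp
    next
      case 2
      then show ?thesis using eq by simp
    qed
  qed (rule I(1) I(2) I'(1) I'(2); assumption?)+
  then have "Z ! (j - 1) = Z' ! (j - 1)" if "j \<in> {1..T}" for j
    using I(4)[OF that] I'(4)[OF that] by simp
  from this[of "Suc k" for k] show ?thesis
    using Z(1) Z'(1) by (intro nth_equalityI) auto
qed

section \<open>Shares of \<open>T\<close> servers and security\<close>

lemma blockA_carrier: "A \<in> carrier_mat a b \<Longrightarrow> blockA L b A i \<in> carrier_mat a (b div L)"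
  by (simp add: blockA_def)

lemma blockB_carrier: "B \<in> carrier_mat b c \<Longrightarrow> blockB L b B i \<in> carrier_mat (b div L) c"
  by (simp add: blockB_def)

lemma inj_on_upload:
  assumes A: "A \<in> carrier_mat a b" and B: "B \<in> carrier_mat b c"
    and Srv: "Srv \<subseteq> {1..N L}" "card Srv = T"
  shows "inj_on (\<lambda>(R, S). map (ftp_upload L T \<alpha> a b c A B R S) (sorted_list_of_set Srv))
           (ftp_rand L T a b c)"
proof (rule inj_onI, clarify)
  fix R S R' S'
  assume RS: "(R, S) \<in> ftp_rand L T a b c" and RS': "(R', S') \<in> ftp_rand L T a b c"
    and eq: "map (ftp_upload L T \<alpha> a b c A B R S) (sorted_list_of_set Srv)
      = map (ftp_upload L T \<alpha> a b c A B R' S') (sorted_list_of_set Srv)"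
  have "finite Srv" using Srv(1) finite_subset by blast
  then have up: "ftp_upload L T \<alpha> a b c A B R S j = ftp_upload L T \<alpha> a b c A B R' S' j" if "j \<in> Srv" for j
    using eq that by simp
  have "R = R'"
    by (rule interp_inj[where X = "blockA L b A", OF blockA_carrier[OF A] _ _ _ _ Srv])
      (use RS RS' up in \<open>auto simp: ftp_rand_def ftp_upload_def ftp_f_eq_interp\<close>)
  moreover have "S = S'"
    by (rule interp_inj[where X = "blockB L b B", OF blockB_carrier[OF B] _ _ _ _ Srv])
      (use RS RS' up in \<open>auto simp: ftp_rand_def ftp_upload_def ftp_g_eq_interp\<close>)
  ultimately show "R = R' \<and> S = S'" ..
qed

text \<open>There are as many \<open>T\<close>-lists of pairs as pairs of \<open>T\<close>-lists, so
  the injective upload map is onto.\<close>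

lemma bij_betw_upload:
  assumes A: "A \<in> carrier_mat a b" and B: "B \<in> carrier_mat b c"
    and Srv: "Srv \<subseteq> {1..N L}" "card Srv = T"
  shows "bij_betw (\<lambda>(R, S). map (ftp_upload L T \<alpha> a b c A B R S) (sorted_list_of_set Srv))
           (ftp_rand L T a b c)
           {ys. set ys \<subseteq> carrier_mat a (b div L) \<times> carrier_mat (b div L) c \<and> length ys = T}"
    (is "bij_betw ?u ?R ?Y")
proof -
  have fin: "finite (carrier_mat a (b div L) :: 'a mat set)" "finite (carrier_mat (b div L) c :: 'a mat set)"
    by (rule finite_carrier_mat)+
  have rand: "?R = {R. set R \<subseteq> carrier_mat a (b div L) \<and> length R = T}
      \<times> {S. set S \<subseteq> carrier_mat (b div L) c \<and> length S = T}"
    by (auto simp: ftp_rand_def)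
  have card: "card ?R = card ?Y"
    unfolding rand using fin
    by (simp add: card_cartesian_product card_lists_length_eq power_mult_distrib)
  have fin_Y: "finite ?Y"
    using fin by (intro finite_lists_length_eq finite_cartesian_product)
  have sub: "?u ` ?R \<subseteq> ?Y"
  proof clarify
    fix R S assume RS: "(R, S) \<in> ?R"
    have "ftp_f L T \<alpha> a b A R \<in> carrier_mat a (b div L)"
      unfolding ftp_f_eq_interp
      by (rule interp(1)[where X = "blockA L b A", OF blockA_carrier[OF A]]) (use RS in \<open>auto simp: ftp_rand_def\<close>)
    moreover have "ftp_g L T \<alpha> b c B S \<in> carrier_mat (b div L) c"
      unfolding ftp_g_eq_interp
      by (rule interp(1)[where X = "blockB L b B", OF blockB_carrier[OF B]]) (use RS in \<open>auto simp: ftp_rand_def\<close>)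
    ultimately show "set (map (ftp_upload L T \<alpha> a b c A B R S) (sorted_list_of_set Srv))
        \<subseteq> carrier_mat a (b div L) \<times> carrier_mat (b div L) c \<and>
      length (map (ftp_upload L T \<alpha> a b c A B R S) (sorted_list_of_set Srv)) = T"
      using Srv(2) by (auto simp: ftp_upload_def)
  qed
  note inj = inj_on_upload[OF A B Srv]
  have "?u ` ?R = ?Y"
    using sub card fin_Y card_image[OF inj] by (intro card_subset_eq) auto
  then show ?thesis
    using inj by (simp add: bij_betw_def)
qed

text \<open>A bijection carries the uniform law to the uniform law on \<open>?Y\<close>, a set in
  which \<open>A\<close> and \<open>B\<close> do not occur.\<close>

lemma secure:
  fixes D :: "('a mat \<times> 'a mat) pmf"
  assumes D: "set_pmf D \<subseteq> carrier_mat a b \<times> carrier_mat b c"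
    and Srv: "Srv \<subseteq> {1..N L}" "card Srv = T"
  shows "prob_space.mutual_information
      (measure_pmf (pair_pmf D (pmf_of_set (ftp_rand L T a b c)))) 2
      (count_space UNIV) (count_space UNIV)
      (\<lambda>((A, B), (R, S)). (A, B))
      (\<lambda>((A, B), (R, S)). map (ftp_upload L T \<alpha> a b c A B R S) (sorted_list_of_set Srv)) = 0"
proof -
  let ?Y = "{ys :: ('a mat \<times> 'a mat) list. set ys \<subseteq> carrier_mat a (b div L) \<times> carrier_mat (b div L) c \<and> length ys = T}"
  define g where "g AB RS = (case (AB, RS) of ((A, B), (R, S)) \<Rightarrow>
    map (ftp_upload L T \<alpha> a b c A B R S) (sorted_list_of_set Srv))" for AB RS
  have "finite ?Y"
    by (intro finite_lists_length_eq finite_cartesian_product finite_carrier_mat)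
  have uniform: "map_pmf (g AB) (pmf_of_set (ftp_rand L T a b c)) = pmf_of_set ?Y" if AB_in: "AB \<in> set_pmf D" for AB
  proof -
    obtain A B where AB: "AB = (A, B)" "A \<in> carrier_mat a b" "B \<in> carrier_mat b c"
      using subsetD[OF D AB_in] by auto
    have bij: "bij_betw (g AB) (ftp_rand L T a b c) ?Y"
    proof -
      have "g AB = (\<lambda>(R, S). map (ftp_upload L T \<alpha> a b c A B R S) (sorted_list_of_set Srv))"
        by (auto simp: g_def AB(1))
      then show ?thesis using bij_betw_upload[OF AB(2,3) Srv] by simp
    qed
    \<comment> \<open>Zero blocks witness that the set under \<open>pmf_of_set\<close> is
      nonempty.\<close>
    have "(replicate T (0\<^sub>m a (b div L)), replicate T (0\<^sub>m (b div L) c)) \<in> ftp_rand L T a b c"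
      by (auto simp: ftp_rand_def)
    then show ?thesis
      using bij \<open>finite ?Y\<close> bij_betw_finite[OF bij]
      by (intro map_pmf_of_set_bij_betw) auto
  qed
  have "(\<lambda>((A, B), (R, S)). (A, B)) = (fst :: ('a mat \<times> 'a mat) \<times> ('a mat list \<times> 'a mat list) \<Rightarrow> _)"
    by (auto simp: fun_eq_iff)
  moreover have "(\<lambda>((A, B), (R, S)). map (ftp_upload L T \<alpha> a b c A B R S) (sorted_list_of_set Srv))
      = (\<lambda>(AB, RS). g AB RS)"
    by (auto simp: fun_eq_iff g_def)
  ultimately show ?thesis
    using mutual_information_eq_0_if_conditional_constant[of D g, OF uniform] by (simp only:)
qed

text \<open>The downloads are additive in \<open>h\<close>, so decoding reduces to a kernel
  statement about the difference \<open>e\<close> of two candidates for an entry of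
  \<open>h\<close>.\<close>

lemma poly_node_eq_0_if_traces_eq_0:
  assumes i: "i \<in> {1..L}" and e: "degree e \<le> 2 * L + 2 * T - 2"
    and tr: "\<And>j. j \<in> {1..N i} \<Longrightarrow>
      field_trace (F i) (ftp_v n \<alpha> (L + j) * ftp_k n L (N i) \<alpha> i (\<alpha> (L + j)) * poly e (\<alpha> (L + j))) = 0"
  shows "poly e (\<alpha> i) = 0"
proof -
  let ?U = "{L+1..L + N i}" and ?k = "\<lambda>j. ftp_k n L (N i) \<alpha> i (\<alpha> j)" and ?v = "ftp_v n \<alpha>"
  let ?W = "{1..n} - (?U \<union> {i})"
  define kp where "kp = (\<Prod>j\<in>?W. [:- \<alpha> j, 1:])"
  have U: "?U \<union> {i} \<subseteq> {1..n}" "i \<notin> ?U"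
    using N_le[OF i] i by auto
  have kp: "poly kp (\<alpha> j) = ?k j" for j
    by (simp add: kp_def poly_prod ftp_k_def)
  have k0: "?k j = 0" if "j \<in> ?W" for j
    unfolding ftp_k_def using that by (intro prod_zero) auto
  have "card ?W = n - card (?U \<union> {i})"
    using U(1) by (subst card_Diff_subset) auto
  moreover have "card (?U \<union> {i}) = Suc (N i)"
    using U(2) by (subst card_Un_disjoint) auto
  moreover have "degree kp = card ?W"
    unfolding kp_def by (subst degree_prod_sum_eq) auto
  ultimately have "degree kp = n - Suc (N i)"
    by (simp only:)
  moreover have "Suc (N i) \<le> n"
    using N_le[OF i] L_pos by simp
  moreover have "N i = p i + 2 * L + 2 * T - 2"
    by (simp add: ftp_N_def)
  \<comment> \<open>The count is tight: \<open>degree kp\<close> is \<open>n - N i - 1\<close>,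
    \<open>s\<close> is at most \<open>p i - 1\<close> and \<open>degree e\<close> at most
    \<open>2 * L + 2 * T - 2\<close>. By the choice of \<open>N i\<close> these bounds add up to
    \<open>n - 2\<close>.\<close>
  ultimately have deg: "s + degree kp + degree e + 2 \<le> n" if "s < p i" for s
    using e that L_pos T_pos by linarith
  define z where "z = ?v i * ?k i * poly e (\<alpha> i)"
  have "z = 0"
  proof (rule eq_0_if_traces_eq_0[OF i])
    fix s assume s: "s < p i"
    let ?t = "\<lambda>j. \<alpha> j ^ s * (?v j * ?k j * poly e (\<alpha> j))"
    define g where "g = monom 1 s * kp * e"
    have "degree g \<le> s + degree kp + degree e"
      unfolding g_def by (intro order_trans[OF degree_mult_le] add_mono degree_monom_le) auto
    then have "(\<Sum>j\<in>{1..n}. inverse (\<Prod>i\<in>{1..n} - {j}. \<alpha> j - \<alpha> i) * poly g (\<alpha> j)) = 0"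
      using deg[OF s] by (intro sum_poly_div_node_differences_eq_0 inj_on_nodes) auto
    then have "(\<Sum>j\<in>{1..n}. ?t j) = 0"
      by (simp add: g_def poly_monom kp ftp_v_def mult_ac)
    moreover have "(\<Sum>j\<in>{1..n}. ?t j) = (\<Sum>j\<in>insert i ?U. ?t j)"
      using U k0 by (intro sum.mono_neutral_right) auto
    moreover have "(\<Sum>j\<in>insert i ?U. ?t j) = ?t i + (\<Sum>j\<in>?U. ?t j)"
      using U(2) by (intro sum.insert) auto
    ultimately have "0 = field_trace (F i) (?t i + (\<Sum>j\<in>?U. ?t j))"
      using field_trace_0[OF i] by simp
    also have "\<dots> = field_trace (F i) (?t i) + (\<Sum>j\<in>?U. field_trace (F i) (?t j))"
      by (simp only: field_trace_add[OF i] field_trace_sum[OF i])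
    \<comment> \<open>Server nodes lie in \<open>F i\<close>, so the factor
      \<open>\<alpha> j ^ s\<close> can be pulled out of the trace; one download per server thus
      serves every \<open>s\<close>.\<close>
    also have "(\<Sum>j\<in>?U. field_trace (F i) (?t j)) = 0"
    proof (rule sum.neutral, rule ballI)
      fix j assume j: "j \<in> ?U"
      then have "\<alpha> j \<in> F i"
        using node_in_K[of j] K_subset_F N_le[OF i] by auto
      then have "\<alpha> j ^ s \<in> F i"
        using is_subfield_F[of i] by (induction s) (auto simp: is_subfield_def)
      moreover have "j - L \<in> {1..N i}" "L + (j - L) = j" using j by auto
      ultimately show "field_trace (F i) (?t j) = 0"
        using tr[of "j - L"] by (simp only: field_trace_scale[OF i] mult_zero_right)
    qed
    finally show "field_trace (F i) (\<alpha> i ^ s * z) = 0"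
      by (simp add: z_def)
  qed
  \<comment> \<open>Distinct nodes make both weights in \<open>z\<close> nonzero, so
    \<open>z = 0\<close> forces the value of \<open>e\<close> to vanish.\<close>
  moreover have "\<alpha> i \<noteq> \<alpha> j" if "j \<in> {1..n} - {i}" for j
    using inj_onD[OF inj_on_nodes, of i j] that i by auto
  then have "?v i \<noteq> 0" "?k i \<noteq> 0"
    by (auto simp: ftp_v_def ftp_k_def)
  ultimately show ?thesis
    by (simp add: z_def)
qed

text \<open>This collects what decoding uses about position \<open>(r, s)\<close>, reducing it to
  scalar polynomials: \<open>h\<close> is an entry of the product of \<open>f\<close> and
  \<open>g\<close>, hence of degree at most twice \<open>L + T - 1\<close>.\<close>

lemma product_entry:
  assumes A: "A \<in> carrier_mat a b" and B: "B \<in> carrier_mat b c"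
    and RS: "(R, S) \<in> ftp_rand L T a b c" and rs: "r < a" "s < c"
  obtains h where "degree h \<le> 2 * L + 2 * T - 2"
    and "\<And>i. i \<in> {1..L} \<Longrightarrow> poly h (\<alpha> i) = (blockA L b A i * blockB L b B i) $$ (r, s)"
    and "\<And>i j. ftp_answer q0 L T p \<alpha> a b c A B R S i j $$ (r, s) =
      field_trace (F i) (ftp_v n \<alpha> (L + j) * ftp_k n L (N i) \<alpha> i (\<alpha> (L + j)) * poly h (\<alpha> (L + j)))"
proof -
  let ?f = "ftp_f L T \<alpha> a b A R" and ?g = "ftp_g L T \<alpha> b c B S"
  have R: "length R = T" "set R \<subseteq> carrier_mat a (b div L)"
    and S: "length S = T" "set S \<subseteq> carrier_mat (b div L) c"
    using RS by (auto simp: ftp_rand_def)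
  note f = interp[where X = "blockA L b A", OF blockA_carrier[OF A] R, folded ftp_f_eq_interp]
    and g = interp[where X = "blockB L b B", OF blockB_carrier[OF B] S, folded ftp_g_eq_interp]
  define h where "h = (\<Sum>t<b div L. ?f $$ (r, t) * ?g $$ (t, s))"
  have h: "(eval_mat ?f x * eval_mat ?g x) $$ (r, s) = poly h x" for x
    unfolding h_def by (rule eval_mat_mult_index[OF f(1) g(1) rs])
  show ?thesis
  proof (rule that[of h])
    have "degree (?f $$ (r, t) * ?g $$ (t, s)) \<le> 2 * L + 2 * T - 2" if "t < b div L" for t
      using degree_mult_le[of "?f $$ (r, t)" "?g $$ (t, s)"] f(2)[OF rs(1) that] g(2)[OF that rs(2)]
      by linarith
    then show "degree h \<le> 2 * L + 2 * T - 2"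
      unfolding h_def by (intro degree_sum_le) auto
    show "poly h (\<alpha> i) = (blockA L b A i * blockB L b B i) $$ (r, s)" if "i \<in> {1..L}" for i
      using h[of "\<alpha> i"] f(3)[OF that] g(3)[OF that] by simp
    show "ftp_answer q0 L T p \<alpha> a b c A B R S i j $$ (r, s) =
      field_trace (F i) (ftp_v n \<alpha> (L + j) * ftp_k n L (N i) \<alpha> i (\<alpha> (L + j)) * poly h (\<alpha> (L + j)))"
      for i j
    proof -
      have "eval_mat ?f (\<alpha> (L + j)) * eval_mat ?g (\<alpha> (L + j)) \<in> carrier_mat a c"
        using f(1) g(1) by (intro mult_carrier_mat eval_mat_carrier)
      then show ?thesis
        using rs unfolding ftp_answer_def ftp_upload_def Let_def fst_conv snd_conv
        by (subst index_map_mat) (auto simp: h simp del: index_mult_mat)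
    qed
  qed
qed

text \<open>The two runs may use different randomness. In each entry the difference of their
  polynomials has vanishing downloaded traces, hence vanishes at the data nodes, where the values
  are the block products.\<close>

lemma download_determines_product:
  assumes A: "A \<in> carrier_mat a b" "A' \<in> carrier_mat a b"
    and B: "B \<in> carrier_mat b c" "B' \<in> carrier_mat b c" and "L dvd b"
    and RS: "(R, S) \<in> ftp_rand L T a b c" "(R', S') \<in> ftp_rand L T a b c"
    and eq: "ftp_download q0 L T p \<alpha> a b c A B R S = ftp_download q0 L T p \<alpha> a b c A' B' R' S'"
  shows "A * B = A' * B'"
proof (rule eq_matI)
  have answers: "ftp_answer q0 L T p \<alpha> a b c A B R S i j = ftp_answer q0 L T p \<alpha> a b c A' B' R' S' i j"
    if "i \<in> {1..L}" "j \<in> {1..N i}" for i j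
    using eq that by (auto simp: ftp_download_def simp del: upt_Suc)
  fix r s assume "r < dim_row (A' * B')" "s < dim_col (A' * B')"
  then have rs: "r < a" "s < c" using A B by auto
  obtain h where h: "degree h \<le> 2 * L + 2 * T - 2"
    "\<And>i. i \<in> {1..L} \<Longrightarrow> poly h (\<alpha> i) = (blockA L b A i * blockB L b B i) $$ (r, s)"
    "\<And>i j. ftp_answer q0 L T p \<alpha> a b c A B R S i j $$ (r, s) =
      field_trace (F i) (ftp_v n \<alpha> (L + j) * ftp_k n L (N i) \<alpha> i (\<alpha> (L + j)) * poly h (\<alpha> (L + j)))"
    using product_entry[OF A(1) B(1) RS(1) rs] by blast
  obtain h' where h': "degree h' \<le> 2 * L + 2 * T - 2"
    "\<And>i. i \<in> {1..L} \<Longrightarrow> poly h' (\<alpha> i) = (blockA L b A' i * blockB L b B' i) $$ (r, s)"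
    "\<And>i j. ftp_answer q0 L T p \<alpha> a b c A' B' R' S' i j $$ (r, s) =
      field_trace (F i) (ftp_v n \<alpha> (L + j) * ftp_k n L (N i) \<alpha> i (\<alpha> (L + j)) * poly h' (\<alpha> (L + j)))"
    using product_entry[OF A(2) B(2) RS(2) rs] by blast
  have "(blockA L b A i * blockB L b B i) $$ (r, s) = (blockA L b A' i * blockB L b B' i) $$ (r, s)"
    if i: "i \<in> {1..L}" for i
  proof -
    have "poly (h - h') (\<alpha> i) = 0"
    proof (rule poly_node_eq_0_if_traces_eq_0[OF i])
      show "degree (h - h') \<le> 2 * L + 2 * T - 2"
        by (rule degree_diff_le) fact+
      fix j assume j: "j \<in> {1..N i}"
      let ?w = "ftp_v n \<alpha> (L + j) * ftp_k n L (N i) \<alpha> i (\<alpha> (L + j))" and ?x = "\<alpha> (L + j)"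
      \<comment> \<open>Writing \<open>h\<close> as \<open>(h - h') + h'\<close> lets additivity of
        the trace suffice.\<close>
      have "field_trace (F i) (?w * poly h ?x)
          = field_trace (F i) (?w * poly (h - h') ?x + ?w * poly h' ?x)"
        by (simp flip: distrib_left)
      also have "\<dots> = field_trace (F i) (?w * poly (h - h') ?x) + field_trace (F i) (?w * poly h' ?x)"
        by (rule field_trace_add[OF i])
      finally show "field_trace (F i) (?w * poly (h - h') ?x) = 0"
        using h(3)[of i j] h'(3)[of i j] answers[OF i j] by simp
    qed
    then show ?thesis using h(2)[OF i] h'(2)[OF i] by simp
  qed
  then show "(A * B) $$ (r, s) = (A' * B') $$ (r, s)"
    using mult_eq_sum_blocks[OF A(1) B(1) \<open>L dvd b\<close> rs] mult_eq_sum_blocks[OF A(2) B(2) \<open>L dvd b\<close> rs]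
    by simp
qed (use A B in auto)

text \<open>\<open>Dec\<close> selects the product compatible with a download. Uniqueness is
  \<open>download_determines_product\<close>, so one function serves all data and all
  randomness.\<close>

lemma decodable:
  assumes "L dvd b"
  shows "\<exists>Dec. \<forall>A\<in>carrier_mat a b. \<forall>B\<in>carrier_mat b c. \<forall>(R, S)\<in>ftp_rand L T a b c.
    Dec (ftp_download q0 L T p \<alpha> a b c A B R S) = A * B"
proof -
  define Dec where "Dec d = (THE M. \<exists>A\<in>carrier_mat a b. \<exists>B\<in>carrier_mat b c. \<exists>(R, S)\<in>ftp_rand L T a b c.
    d = ftp_download q0 L T p \<alpha> a b c A B R S \<and> M = A * B)" for d
  have "Dec (ftp_download q0 L T p \<alpha> a b c A B R S) = A * B"
    if "A \<in> carrier_mat a b" "B \<in> carrier_mat b c" "(R, S) \<in> ftp_rand L T a b c" for A B R S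
    unfolding Dec_def
  proof (rule the_equality)
    fix M assume "\<exists>A'\<in>carrier_mat a b. \<exists>B'\<in>carrier_mat b c. \<exists>(R', S')\<in>ftp_rand L T a b c.
      ftp_download q0 L T p \<alpha> a b c A B R S = ftp_download q0 L T p \<alpha> a b c A' B' R' S' \<and> M = A' * B'"
    then obtain A' B' R' S' where *: "A' \<in> carrier_mat a b" "B' \<in> carrier_mat b c"
      "(R', S') \<in> ftp_rand L T a b c" "M = A' * B'"
      "ftp_download q0 L T p \<alpha> a b c A B R S = ftp_download q0 L T p \<alpha> a b c A' B' R' S'"
      by blast
    show "M = A * B"
      using download_determines_product[OF that(1) *(1) that(2) *(2) assms that(3) *(3,5)] *(4) by simp
  qed (use that in blast)
  then show ?thesis by blast
qed

end

section \<open>Communication rate\<close>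

context ftp_params
begin

text \<open>Upload and download are both multiples of \<open>a * c * ?P\<close>, which cancels: an
  element of \<open>F i\<close> counts \<open>?P / p i\<close> symbols, and
  \<open>a * m + m * c\<close> is \<open>a * c * m * (1 / a + 1 / c)\<close> for the block width
  \<open>m\<close>.\<close>

lemma rate:
  assumes "a > 0" "c > 0" "L dvd b"
  shows "ftp_rate L T p a b c =
       1 / (real (ftp_N p L T L) * real b / real L * (1 / real a + 1 / real c)
            + (\<Sum>i\<in>{1..L}. real (ftp_N p L T i) / real (p i)))"
proof -
  let ?P = "\<Prod>j\<in>{1..L}. p j" and ?N = "ftp_N p L T"
  have down: "real (\<Sum>i\<in>{1..L}. ?N i * (a * c) * (\<Prod>j\<in>{1..L} - {i}. p j))
      = real (a * c * ?P) * (\<Sum>i\<in>{1..L}. real (?N i) / real (p i))"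
    unfolding of_nat_sum sum_distrib_left
  proof (rule sum.cong)
    fix i assume i: "i \<in> {1..L}"
    show "real (?N i * (a * c) * (\<Prod>j\<in>{1..L} - {i}. p j)) = real (a * c * ?P) * (real (?N i) / real (p i))"
      using p_pos[OF i] by (simp only: prod_p_split[OF i]) (simp add: field_simps)
  qed simp
  obtain m where m: "b = L * m"
    using \<open>L dvd b\<close> by blast
  have "real (?N L) * real b / real L = real (?N L) * real m"
    using L_pos by (simp add: m)
  then have up: "real (?N L * (a * (b div L) + (b div L) * c) * ?P)
      = real (a * c * ?P) * (real (?N L) * real b / real L * (1 / real a + 1 / real c))"
    using assms(1,2) L_pos by (simp add: m field_simps)
  have cancel: "x \<noteq> 0 \<Longrightarrow> x / (x * y + x * z) = 1 / (y + z)" for x y z :: real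
    by (simp flip: distrib_left)
  have "real (a * c * ?P) \<noteq> 0"
    using assms(1,2) prod_p_pos by simp
  then show ?thesis
    unfolding ftp_rate_def Let_def of_nat_add up down
    by (rule cancel)
qed

end

theorem theorem1:
  fixes L T q0 a b c :: nat and p :: "nat \<Rightarrow> nat"
    and field_type :: "'a::{field,finite} itself"
  assumes L_pos: "L > 0" and T_pos: "T > 0"
    and p_prime: "\<forall>i\<in>{1..L}. prime (p i)"
    and p_mono: "\<forall>i\<in>{1..L}. \<forall>j\<in>{1..L}. i < j \<longrightarrow> p i < p j"
    and q0_pp: "\<exists>r k. prime r \<and> k > 0 \<and> q0 = r ^ k"
    and q0_ge: "q0 \<ge> ftp_N p L T L"
    and card_q: "CARD('a) = q0 ^ (\<Prod>i\<in>{1..L}. p i)"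
    and dims: "a > 0" "b > 0" "c > 0" "L dvd b"
  shows
    "(\<exists>\<alpha> :: nat \<Rightarrow> 'a. ftp_nodes q0 L T p \<alpha>) \<and>
     (\<forall>\<alpha> :: nat \<Rightarrow> 'a. ftp_nodes q0 L T p \<alpha> \<longrightarrow>
        \<comment> \<open>T-security\<close>
        (\<forall>D :: ('a mat \<times> 'a mat) pmf. set_pmf D \<subseteq> carrier_mat a b \<times> carrier_mat b c \<longrightarrow>
          (\<forall>Srv \<subseteq> {1..ftp_N p L T L}. card Srv = T \<longrightarrow>
             prob_space.mutual_information
               (measure_pmf (pair_pmf D (pmf_of_set (ftp_rand L T a b c)))) 2
               (count_space UNIV) (count_space UNIV)
               (\<lambda>((A, B), (R, S)). (A, B))
               (\<lambda>((A, B), (R, S)). map (ftp_upload L T \<alpha> a b c A B R S) (sorted_list_of_set Srv))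
             = 0)) \<and>
        \<comment> \<open>decodability\<close>
        (\<exists>Dec. \<forall>A\<in>carrier_mat a b. \<forall>B\<in>carrier_mat b c. \<forall>(R, S)\<in>ftp_rand L T a b c.
            Dec (ftp_download q0 L T p \<alpha> a b c A B R S) = A * B)) \<and>
     \<comment> \<open>total communication rate\<close>
     ftp_rate L T p a b c =
       1 / (real (ftp_N p L T L) * real b / real L * (1 / real a + 1 / real c)
            + (\<Sum>i\<in>{1..L}. real (ftp_N p L T i) / real (p i)))"
proof -
  interpret ftp_params L T q0 p field_type
    by unfold_locales (use assms in auto)
  have code: "ftp_code L T q0 p \<alpha>" if "ftp_nodes q0 L T p \<alpha>" for \<alpha> :: "nat \<Rightarrow> 'a"
    by unfold_locales (fact that)
  show ?thesis
    using ex_nodes rate[OF dims(1,3,4)] ftp_code.secure[OF code] ftp_code.decodable[OF code dims(4)]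
    by (intro conjI allI impI)
qed

end
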